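(* Let $w\in S_n$. The map $\mathrm{top}_w:S_n\to S_n$ is order preserving with respect to right weak order; that is, if $x\leq_R y$ then $\mathrm{top}_w(x)\leq_R\mathrm{top}_w(y)$. Furthermore, the quotient $\mathrm{Weak}_R(S_n)/\Theta_w$ is isomorphic to $P_w$ via the map $[x]_w\mapsto\mathrm{bot}_w(x)$.
   Context: $S_n$ is the symmetric group with simple generators $s_i=(i\ i+1)$, Coxeter length $\ell$, and identity $e$. The (strong) Bruhat order $\preceq$ on $S_n$ has cover relations $x \prec xt$ whenever $t$ is a transposition with $\ell(xt)=\ell(x)+1$; write $[e,w]=\{u\mid u\preceq w\}$. The right weak order $\leq_R$ on $S_n$ has cover relations $x\lessdot_R xs$ whenever $s$ is a simple generator with $\ell(xs)=\ell(x)+1$; $\mathrm{Weak}_R(S_n)$ denotes $S_n$ with this order. For $u\in S_n$ let $\boldsymbol{u}=(u^{-1}(1),\ldots,u^{-1}(n))\in\mathbb{R}^n$. The Bruhat interval polytope of $w$ is $Q_w=\mathrm{Conv}(\{\boldsymbol{u}\mid u\preceq w\})$; its vertices are exactly the points $\boldsymbol{u}$ with $u\in[e,w]$. The 1-skeleton poset $(P_w,\leq_w)$ has underlying set $[e,w]$ and cover relations $u\lessdot_w v$ whenever $Q_w$ has an edge between $\boldsymbol{u}$ and $\boldsymbol{v}$ and $\ell(v)>\ell(u)$. The normal cone of a vertex $\boldsymbol{u}$ of $Q_w$ is $C_w(\boldsymbol{u})=\{x\in\mathbb{R}^n\mid \boldsymbol{u}\in\mathrm{argmax}_{x'\in Q_w}\langle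 x,x'\rangle\}$. For $y\in S_n$ let $C_{w_0}(\boldsymbol{y})$ be the closed cone of the braid arrangement (hyperplanes $x_i=x_j$) containing $\boldsymbol{y}$ in its interior. $Q_w$ is a generalized permutohedron: each $C_w(\boldsymbol{u})$ is a union of cones $C_{w_0}(\boldsymbol{y})$. The equivalence relation $\Theta_w$ on $S_n$ is defined by $y\sim y'$ iff $C_{w_0}(\boldsymbol{y})$ and $C_{w_0}(\boldsymbol{y'})$ lie in the same cone $C_w(\boldsymbol{u})$, $u\in[e,w]$; $[y]_w$ denotes the class of $y$. Each class is an interval in right weak order, $[x]_w=\{z\mid \mathrm{bot}_w(x)\leq_R z\leq_R\mathrm{top}_w(x)\}$, which defines $\mathrm{bot}_w(x)$ and $\mathrm{top}_w(x)$; moreover $\mathrm{bot}_w(x)$ is the unique element of $[x]_w\cap[e,w]$. $\mathrm{Weak}_R(S_n)/\Theta_w$ is the set of equivalence classes with the relation $\leq_{\Theta_w}$ defined by $[x]_w\leq_{\Theta_w}[y]_w$ iff there exist $x'\in[x]_w$ and $y'\in[y]_w$ with $x'\leq_R y'$. *)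

theory Defs
  imports "HOL-Analysis.Analysis" "HOL-Combinatorics.Permutations"
begin

text \<open>
  The symmetric group on \<open>{1..n}\<close>. Products are ordinary composition, \<open>xy = x \<circ> y\<close>, so that
  right multiplication by \<open>s_i\<close> exchanges the values \<open>i\<close> and \<open>i + 1\<close> of \<open>x\<^sup>-\<^sup>1\<close>.
\<close>

definition Sym :: "nat \<Rightarrow> (nat \<Rightarrow> nat) set" where
  "Sym n = {u. u permutes {1..n}}"

definition simple_gen :: "nat \<Rightarrow> nat \<Rightarrow> nat" where
  "simple_gen i = Transposition.transpose i (i + 1)"

definition word_product :: "nat list \<Rightarrow> nat \<Rightarrow> nat" where
  "word_product is = foldr (\<lambda>i u. simple_gen i \<circ> u) is id"

definition coxeter_length :: "nat \<Rightarrow> (nat \<Rightarrow> nat) \<Rightarrow> nat" where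
  "coxeter_length n u =
     (LEAST k. \<exists>is. length is = k \<and> set is \<subseteq> {1..<n} \<and> word_product is = u)"

definition weak_cover :: "nat \<Rightarrow> (nat \<Rightarrow> nat) \<Rightarrow> (nat \<Rightarrow> nat) \<Rightarrow> bool" where
  "weak_cover n x y \<longleftrightarrow> x \<in> Sym n \<and>
     (\<exists>i\<in>{1..<n}. y = x \<circ> simple_gen i) \<and> coxeter_length n y = coxeter_length n x + 1"

definition weak_le :: "nat \<Rightarrow> (nat \<Rightarrow> nat) \<Rightarrow> (nat \<Rightarrow> nat) \<Rightarrow> bool" where
  "weak_le n = (weak_cover n)\<^sup>*\<^sup>*"

definition bruhat_cover :: "nat \<Rightarrow> (nat \<Rightarrow> nat) \<Rightarrow> (nat \<Rightarrow> nat) \<Rightarrow> bool" where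
  "bruhat_cover n x y \<longleftrightarrow> x \<in> Sym n \<and>
     (\<exists>a\<in>{1..n}. \<exists>b\<in>{1..n}. a \<noteq> b \<and> y = x \<circ> Transposition.transpose a b) \<and>
     coxeter_length n y = coxeter_length n x + 1"

definition bruhat_le :: "nat \<Rightarrow> (nat \<Rightarrow> nat) \<Rightarrow> (nat \<Rightarrow> nat) \<Rightarrow> bool" where
  "bruhat_le n = (bruhat_cover n)\<^sup>*\<^sup>*"

definition bruhat_lower :: "nat \<Rightarrow> (nat \<Rightarrow> nat) \<Rightarrow> (nat \<Rightarrow> nat) set" where
  "bruhat_lower n w = {u \<in> Sym n. bruhat_le n u w}"

text \<open>
  Since the index type of \<^typ>\<open>real ^ 'n\<close> has no preferred numbering, the geometric notions take a
  numbering \<open>c\<close> of the coordinates as a parameter: a bijection from the index type to \<open>{1..n}\<close>,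
  so that \<open>v $ j\<close> is the coordinate of \<open>v\<close> with number \<open>c j\<close>.
\<close>

definition perm_point :: "('n::finite \<Rightarrow> nat) \<Rightarrow> (nat \<Rightarrow> nat) \<Rightarrow> real ^ 'n" where
  "perm_point c u = (\<chi> j. real (inv u (c j)))"

definition bruhat_polytope ::
  "nat \<Rightarrow> ('n::finite \<Rightarrow> nat) \<Rightarrow> (nat \<Rightarrow> nat) \<Rightarrow> (real ^ 'n) set" where
  "bruhat_polytope n c w = convex hull (perm_point c ` bruhat_lower n w)"

definition skeleton_cover ::
  "nat \<Rightarrow> ('n::finite \<Rightarrow> nat) \<Rightarrow> (nat \<Rightarrow> nat) \<Rightarrow> (nat \<Rightarrow> nat) \<Rightarrow> (nat \<Rightarrow> nat) \<Rightarrow> bool" where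
  "skeleton_cover n c w u v \<longleftrightarrow> u \<in> bruhat_lower n w \<and> v \<in> bruhat_lower n w \<and>
     closed_segment (perm_point c u) (perm_point c v) edge_of bruhat_polytope n c w \<and>
     coxeter_length n u < coxeter_length n v"

definition skeleton_le ::
  "nat \<Rightarrow> ('n::finite \<Rightarrow> nat) \<Rightarrow> (nat \<Rightarrow> nat) \<Rightarrow> (nat \<Rightarrow> nat) \<Rightarrow> (nat \<Rightarrow> nat) \<Rightarrow> bool" where
  "skeleton_le n c w = (skeleton_cover n c w)\<^sup>*\<^sup>*"

definition normal_cone ::
  "nat \<Rightarrow> ('n::finite \<Rightarrow> nat) \<Rightarrow> (nat \<Rightarrow> nat) \<Rightarrow> (nat \<Rightarrow> nat) \<Rightarrow> (real ^ 'n) set" where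
  "normal_cone n c w u =
     {x. is_arg_max (\<lambda>z. x \<bullet> z) (\<lambda>z. z \<in> bruhat_polytope n c w) (perm_point c u)}"

definition braid_hyperplanes :: "(real ^ 'n::finite) set set" where
  "braid_hyperplanes = {{x. x $ i = x $ j} | i j. i \<noteq> j}"

text \<open>
  The closed cones of the arrangement are the closures of the connected components of its complement.
\<close>

definition braid_cone :: "('n::finite \<Rightarrow> nat) \<Rightarrow> (nat \<Rightarrow> nat) \<Rightarrow> (real ^ 'n) set" where
  "braid_cone c y =
     closure (connected_component_set (- \<Union>braid_hyperplanes) (perm_point c y))"

definition Theta ::
  "nat \<Rightarrow> ('n::finite \<Rightarrow> nat) \<Rightarrow> (nat \<Rightarrow> nat) \<Rightarrow> ((nat \<Rightarrow> nat) \<times> (nat \<Rightarrow> nat)) set" where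
  "Theta n c w = {(y, y'). y \<in> Sym n \<and> y' \<in> Sym n \<and>
     (\<exists>u \<in> bruhat_lower n w.
        braid_cone c y \<subseteq> normal_cone n c w u \<and> braid_cone c y' \<subseteq> normal_cone n c w u)}"

definition Theta_class ::
  "nat \<Rightarrow> ('n::finite \<Rightarrow> nat) \<Rightarrow> (nat \<Rightarrow> nat) \<Rightarrow> (nat \<Rightarrow> nat) \<Rightarrow> (nat \<Rightarrow> nat) set" where
  "Theta_class n c w x = Theta n c w `` {x}"

definition is_weak_interval ::
  "nat \<Rightarrow> (nat \<Rightarrow> nat) set \<Rightarrow> (nat \<Rightarrow> nat) \<Rightarrow> (nat \<Rightarrow> nat) \<Rightarrow> bool" where
  "is_weak_interval n C b t \<longleftrightarrow>
     b \<in> C \<and> t \<in> C \<and> C = {z. weak_le n b z \<and> weak_le n z t}"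

definition bot_elt ::
  "nat \<Rightarrow> ('n::finite \<Rightarrow> nat) \<Rightarrow> (nat \<Rightarrow> nat) \<Rightarrow> (nat \<Rightarrow> nat) \<Rightarrow> (nat \<Rightarrow> nat)" where
  "bot_elt n c w x = (THE b. \<exists>t. is_weak_interval n (Theta_class n c w x) b t)"

definition top_elt ::
  "nat \<Rightarrow> ('n::finite \<Rightarrow> nat) \<Rightarrow> (nat \<Rightarrow> nat) \<Rightarrow> (nat \<Rightarrow> nat) \<Rightarrow> (nat \<Rightarrow> nat)" where
  "top_elt n c w x = (THE t. \<exists>b. is_weak_interval n (Theta_class n c w x) b t)"

definition quotient_le :: "nat \<Rightarrow> (nat \<Rightarrow> nat) set \<Rightarrow> (nat \<Rightarrow> nat) set \<Rightarrow> bool" where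
  "quotient_le n C D \<longleftrightarrow> (\<exists>x'\<in>C. \<exists>y'\<in>D. weak_le n x' y')"

end

theory Submission
  imports Defs
begin

text \<open>
  A chamber of the braid arrangement is a permutation \<open>y\<close>: it contains the functionals that increase
  along \<open>y(1), \<dots>, y(n)\<close>. Such a functional takes a larger value at the point of \<open>u\<close> the lower
  \<open>y\<^sup>-\<^sup>1u\<close> is in the Bruhat order (\<open>pairing_antimono\<close>). The set of all \<open>y\<^sup>-\<^sup>1u\<close> with \<open>u \<preceq> w\<close>
  has a Bruhat minimum, which is found by peeling simple generators off \<open>w\<close> on the right
  (\<open>lower_has_min\<close>). So a single \<open>u \<preceq> w\<close>, called \<open>vertex y\<close> below, maximises every functional of
  the chamber, and \<open>\<Theta>\<^sub>w\<close> is the kernel of \<open>vertex\<close> (\<open>Theta_iff\<close>).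

  Everything else rests on one rule (\<open>vertex_step\<close>). Let \<open>y s\<^sub>i\<close> cover \<open>y\<close>, so that it exchanges
  neighbouring values \<open>a < b\<close> of \<open>y\<close>. Then \<open>a\<close> precedes \<open>b\<close> in \<open>u = vertex y\<close>, and
  \<open>vertex (y s\<^sub>i)\<close> is \<open>(a b)u\<close> if this lies below \<open>w\<close>, and \<open>u\<close> otherwise. In particular the
  length of the vertex never drops along the weak order, which makes the classes convex. The
  inversions of \<open>vertex y\<close> are inversions of \<open>y\<close> (\<open>vertex_inversions\<close>), so \<open>vertex y\<close> is the
  bottom of its class.

  For the tops, let \<open>x s\<^sub>i\<close> and \<open>x s\<^sub>j\<close> be two covers of \<open>x\<close>. If \<open>x s\<^sub>j\<close> is equivalent to \<open>x\<close>,
  then \<open>x s\<^sub>i\<close> is equivalent to the join of the two covers (\<open>vertex_polygon\<close>): the rule allows only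
  one change of vertex between \<open>x\<close> and the join, as all others would need an element above a
  permutation already known not to lie below \<open>w\<close>. A confluence argument by descending induction on
  the length turns this local statement into the existence of a greatest element in each class
  (\<open>greatest_above\<close>) and into the monotonicity of the top (\<open>class_top_mono_cover\<close>).

  For the isomorphism, a cover of the weak order that changes the vertex gives an edge, because the
  functionals inside the wall between the two chambers are maximal on precisely that segment
  (\<open>skeleton_cover_if_weak_cover\<close>). Conversely, let a functional \<open>a\<close> expose an edge. The chambers
  whose closure contains \<open>a\<close> have a weak order minimum, obtained by sorting the coordinates of \<open>a\<close>
  and breaking ties naturally. Pushing \<open>a\<close> slightly towards an end of the edge yields a chamber
  above this minimum that belongs to that end, and by length the minimum itself belongs to the
  shorter end (\<open>weak_le_if_skeleton_cover\<close>). As the tops are monotone, classes are related in the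
  quotient exactly when their tops are, so the transitive closure of the edges is the quotient order.
\<close>

section \<open>Permutations, inversions and length\<close>

lemma Sym_id: "id \<in> Sym n"
  by (simp add: Sym_def permutes_id)

lemma Sym_comp: "x \<in> Sym n \<Longrightarrow> y \<in> Sym n \<Longrightarrow> x \<circ> y \<in> Sym n"
  by (simp add: Sym_def permutes_compose)

lemma Sym_inv: "x \<in> Sym n \<Longrightarrow> inv x \<in> Sym n"
  by (simp add: Sym_def permutes_inv)

lemma Sym_transpose:
  "a \<in> {1..n} \<Longrightarrow> b \<in> {1..n} \<Longrightarrow> Transposition.transpose a b \<in> Sym n"
  unfolding Sym_def by (simp add: permutes_swap_id)

lemma Sym_simple_gen: "i \<in> {1..<n} \<Longrightarrow> simple_gen i \<in> Sym n"
  unfolding simple_gen_def by (rule Sym_transpose) auto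

lemma Sym_bij: "x \<in> Sym n \<Longrightarrow> bij x"
  by (simp add: Sym_def permutes_bij)

lemma finite_Sym: "finite (Sym n)"
  unfolding Sym_def by (rule finite_permutations) simp

lemma Sym_app: "x \<in> Sym n \<Longrightarrow> x k \<in> {1..n} \<longleftrightarrow> k \<in> {1..n}"
  unfolding Sym_def by (simp only: mem_Collect_eq permutes_in_image)

lemma Sym_app_mem: "x \<in> Sym n \<Longrightarrow> k \<in> {1..n} \<Longrightarrow> x k \<in> {1..n}"
  using Sym_app by blast

lemma Sym_inv_app [simp]:
  assumes "x \<in> Sym n"
  shows "x (inv x k) = k" "inv x (x k) = k" "x \<circ> inv x = id" "inv x \<circ> x = id" "inv (inv x) = x"
  using Sym_bij[OF assms]
  by (auto simp: bij_is_surj surj_f_inv_f bij_is_inj inv_inv_eq surj_iff[symmetric] inj_iff[symmetric])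

lemma Sym_eq_iff: "x \<in> Sym n \<Longrightarrow> x i = x j \<longleftrightarrow> i = j"
  by (metis Sym_inv_app(2))

lemma Sym_inv_eq_iff: "x \<in> Sym n \<Longrightarrow> inv x i = inv x j \<longleftrightarrow> i = j"
  by (metis Sym_inv_app(1))

lemma inv_comp_Sym: "x \<in> Sym n \<Longrightarrow> y \<in> Sym n \<Longrightarrow> inv (x \<circ> y) = inv y \<circ> inv x"
  by (simp add: Sym_bij o_inv_distrib)

lemma inv_transpose_comp:
  "x \<in> Sym n \<Longrightarrow> inv (Transposition.transpose a b \<circ> x) = inv x \<circ> Transposition.transpose a b"
  by (simp add: Sym_bij o_inv_distrib)

lemma inv_comp_transpose:
  "x \<in> Sym n \<Longrightarrow> inv (x \<circ> Transposition.transpose a b) = Transposition.transpose a b \<circ> inv x"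
  by (simp add: Sym_bij o_inv_distrib)

text \<open>
  Exchanging two positions is the same as exchanging the two values found there. Chambers are crossed
  by exchanging positions, edges of the polytope exchange values, so both forms are needed.
\<close>

lemma comp_transpose_eq:
  assumes "x \<in> Sym n"
  shows "x \<circ> Transposition.transpose p q = Transposition.transpose (x p) (x q) \<circ> x"
  using assms by (auto simp: fun_eq_iff Transposition.transpose_def Sym_eq_iff)

lemma transpose_comp_eq:
  assumes "x \<in> Sym n"
  shows "Transposition.transpose a b \<circ> x = x \<circ> Transposition.transpose (inv x a) (inv x b)"
  using assms comp_transpose_eq[OF assms, of "inv x a" "inv x b"] by simp

lemma comp_cancel:
  assumes "u \<in> Sym n" "v \<in> Sym n" "y \<in> Sym n" "inv u \<circ> y = inv v \<circ> y"
  shows "u = v"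
proof -
  have "inv u \<circ> y \<circ> inv y = inv v \<circ> y \<circ> inv y" using assms(4) by simp
  then have "inv u = inv v" by (simp only: comp_assoc Sym_inv_app(3)[OF assms(3)] comp_id)
  then show ?thesis using assms by (metis Sym_inv_app(5))
qed

lemma simple_gen_app [simp]: "simple_gen i i = Suc i" "simple_gen i (Suc i) = i"
  by (simp_all add: simple_gen_def)

lemma simple_gen_invol [simp]: "x \<circ> simple_gen i \<circ> simple_gen i = x"
  by (simp add: simple_gen_def comp_assoc)

text \<open>
  Inversions are recorded as pairs of values rather than positions. Then right multiplication by
  \<open>s\<^sub>i\<close> adds or removes a single pair and leaves the others in place, and the right weak order
  becomes inclusion.
\<close>

definition Inv :: "nat \<Rightarrow> (nat \<Rightarrow> nat) \<Rightarrow> (nat \<times> nat) set" where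
  "Inv n u = {(a, b). a \<in> {1..n} \<and> b \<in> {1..n} \<and> a < b \<and> inv u b < inv u a}"

definition ilen :: "nat \<Rightarrow> (nat \<Rightarrow> nat) \<Rightarrow> nat" where
  "ilen n u = card (Inv n u)"

lemma Inv_iff:
  "(a, b) \<in> Inv n u \<longleftrightarrow> a \<in> {1..n} \<and> b \<in> {1..n} \<and> a < b \<and> inv u b < inv u a"
  by (simp add: Inv_def)

lemma finite_Inv: "finite (Inv n u)"
  by (rule finite_subset[of _ "{1..n} \<times> {1..n}"]) (auto simp: Inv_def)

lemma ilen_le: "ilen n u \<le> n * n"
proof -
  have "card (Inv n u) \<le> card ({1..n} \<times> {1..n})"
    by (rule card_mono) (auto simp: Inv_def)
  then show ?thesis by (simp add: ilen_def)
qed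

lemma ilen_id: "ilen n id = 0"
  by (simp add: ilen_def Inv_def card_eq_0_iff)

text \<open>
  The only pair of numbers whose order \<open>s\<^sub>i\<close> reverses is \<open>i, i + 1\<close>.
\<close>

lemma simple_gen_less:
  assumes "p \<noteq> q" "{p, q} \<noteq> {i, Suc i}"
  shows "simple_gen i p < simple_gen i q \<longleftrightarrow> p < q"
  using assms by (auto simp: simple_gen_def Transposition.transpose_def split: if_splits)

lemma Inv_simple_gen:
  assumes u: "u \<in> Sym n" and i: "i \<in> {1..<n}" and lt: "u i < u (Suc i)"
  shows "Inv n (u \<circ> simple_gen i) = insert (u i, u (Suc i)) (Inv n u)"
    and "(u i, u (Suc i)) \<notin> Inv n u"
proof -
  have r: "u i \<in> {1..n}" "u (Suc i) \<in> {1..n}" 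
    using i Sym_app_mem[OF u, of i] Sym_app_mem[OF u, of "Suc i"] by auto
  show "(u i, u (Suc i)) \<notin> Inv n u"
    using u by (simp add: Inv_iff)
  have inv: "inv (u \<circ> simple_gen i) k = simple_gen i (inv u k)" for k
    using u by (simp add: simple_gen_def inv_comp_transpose)
  have "(a, b) \<in> Inv n (u \<circ> simple_gen i) \<longleftrightarrow> (a, b) \<in> insert (u i, u (Suc i)) (Inv n u)" for a b
  proof (cases "a = b \<or> {inv u b, inv u a} \<noteq> {i, Suc i}")
    case True
    then have "simple_gen i (inv u b) < simple_gen i (inv u a) \<longleftrightarrow> inv u b < inv u a"
      using simple_gen_less[of "inv u b" "inv u a" i] by (metis less_irrefl)
    moreover have "(a, b) \<noteq> (u i, u (Suc i))"
      using True lt u by auto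
    ultimately show ?thesis by (auto simp add: Inv_iff inv)
  next
    case False
    then consider "inv u a = i" "inv u b = Suc i" | "inv u a = Suc i" "inv u b = i"
      by (auto simp: doubleton_eq_iff)
    then show ?thesis
    proof cases
      case 1
      then have "a = u i" "b = u (Suc i)" using u Sym_inv_app(1) by metis+
      then show ?thesis using 1 lt r by (simp add: Inv_iff inv)
    next
      case 2
      then have "a = u (Suc i)" "b = u i" using u Sym_inv_app(1) by metis+
      then show ?thesis using 2 lt r by (simp add: Inv_iff inv)
    qed
  qed
  then show "Inv n (u \<circ> simple_gen i) = insert (u i, u (Suc i)) (Inv n u)"
    by auto
qed

lemma ilen_simple_gen_up:
  assumes "u \<in> Sym n" "i \<in> {1..<n}" "u i < u (Suc i)"
  shows "ilen n (u \<circ> simple_gen i) = ilen n u + 1"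
  using Inv_simple_gen[OF assms] finite_Inv by (simp add: ilen_def)

lemma ilen_simple_gen_down:
  assumes "u \<in> Sym n" "i \<in> {1..<n}" "u (Suc i) < u i"
  shows "ilen n u = ilen n (u \<circ> simple_gen i) + 1"
proof -
  have "u \<circ> simple_gen i \<in> Sym n" using assms Sym_comp Sym_simple_gen by blast
  from ilen_simple_gen_up[OF this assms(2)] show ?thesis
    using assms(3) by (simp only: simple_gen_invol) simp
qed

lemma asc_or_desc:
  assumes "u \<in> Sym n"
  shows "u i < u (Suc i) \<or> u (Suc i) < u i"
  using Sym_eq_iff[OF assms, of i "Suc i"] by auto

text \<open>
  Without a descent \<open>u\<close> is increasing, so \<open>u k \<ge> k\<close> throughout, and a permutation with this
  property fixes \<open>n\<close>, then \<open>n - 1\<close>, and so on downwards.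
\<close>

lemma id_or_descent:
  assumes u: "u \<in> Sym n" and asc: "\<And>i. i \<in> {1..<n} \<Longrightarrow> u i < u (Suc i)"
  shows "u = id"
proof -
  have ge: "k \<le> n \<longrightarrow> k \<le> u k" for k
  proof (induction k)
    case (Suc k)
    show ?case
    proof
      assume le: "Suc k \<le> n"
      show "Suc k \<le> u (Suc k)"
      proof (cases "k = 0")
        case True
        then show ?thesis using Sym_app_mem[OF u, of 1] le by simp
      next
        case False
        then show ?thesis using Suc asc[of k] le by simp
      qed
    qed
  qed simp
  have "k \<in> {1..n} \<longrightarrow> u k = k" for k
  proof (induction k rule: measure_induct_rule[of "\<lambda>k. n - k"])
    case (less k)
    show ?case
    proof
      assume k: "k \<in> {1..n}"
      show "u k = k"
      proof (rule ccontr)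
        assume "u k \<noteq> k"
        with ge k have gt: "k < u k" by (metis atLeastAtMost_iff le_neq_implies_less)
        have "u k \<in> {1..n}" using Sym_app_mem[OF u k] .
        with less[of "u k"] gt k have "u (u k) = u k" by auto
        with gt Sym_eq_iff[OF u] show False by simp
      qed
    qed
  qed
  moreover have "k \<notin> {1..n} \<Longrightarrow> u k = k" for k
    using u unfolding Sym_def by (metis mem_Collect_eq permutes_not_in)
  ultimately show ?thesis by (metis eq_id_iff)
qed

lemma word_product_Nil: "word_product [] = id"
  by (simp add: word_product_def fun_eq_iff)

lemma word_product_Cons: "word_product (i # is) = simple_gen i \<circ> word_product is"
  by (simp add: word_product_def fun_eq_iff)

lemma word_product_append:
  "word_product (is @ js) = word_product is \<circ> word_product js"
  by (induction "is") (simp_all add: word_product_Nil word_product_Cons comp_assoc)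

lemma word_product_snoc: "word_product (is @ [i]) = word_product is \<circ> simple_gen i"
  by (simp only: word_product_append word_product_Cons word_product_Nil comp_id)

lemma word_product_Sym: "set is \<subseteq> {1..<n} \<Longrightarrow> word_product is \<in> Sym n"
proof (induction "is")
  case Nil
  show ?case unfolding word_product_Nil by (rule Sym_id)
next
  case (Cons i "is")
  have "i \<in> {1..<n}" "word_product is \<in> Sym n" using Cons by auto
  then show ?case unfolding word_product_Cons by (intro Sym_comp Sym_simple_gen)
qed

lemma ilen_word_product: "set is \<subseteq> {1..<n} \<Longrightarrow> ilen n (word_product is) \<le> length is"
proof (induction "is" rule: rev_induct)
  case Nil
  then show ?case unfolding word_product_Nil ilen_id by simp
next
  case (snoc i "is")
  let ?u = "word_product is"
  have u: "?u \<in> Sym n" and i: "i \<in> {1..<n}" using snoc word_product_Sym by auto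
  have "ilen n (?u \<circ> simple_gen i) \<le> ilen n ?u + 1"
    using asc_or_desc[OF u, of i] ilen_simple_gen_up[OF u i] ilen_simple_gen_down[OF u i] by linarith
  moreover have "ilen n ?u \<le> length is" using snoc by simp
  ultimately show ?case by (simp add: word_product_snoc o_def)
qed

text \<open>
  Sorting \<open>u\<close> by removing one descent at a time loses exactly one inversion per step.
\<close>

lemma reduced_word:
  assumes "u \<in> Sym n"
  shows "\<exists>is. length is = ilen n u \<and> set is \<subseteq> {1..<n} \<and> word_product is = u"
  using assms
proof (induction "ilen n u" arbitrary: u rule: less_induct)
  case less
  show ?case
  proof (cases "u = id")
    case True
    then show ?thesis by (intro exI[of _ "[]"]) (simp add: ilen_id word_product_Nil)
  next
    case False
    then obtain i where i: "i \<in> {1..<n}" "\<not> u i < u (Suc i)"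
      using id_or_descent[OF less.prems] by blast
    then have d: "u (Suc i) < u i" using asc_or_desc[OF less.prems, of i] by blast
    let ?v = "u \<circ> simple_gen i"
    have l: "ilen n u = ilen n ?v + 1" using ilen_simple_gen_down[OF less.prems i(1) d] .
    have v: "?v \<in> Sym n" using less.prems i Sym_comp Sym_simple_gen by blast
    from less.hyps[OF _ v] l obtain "is" where
      "length is = ilen n ?v" "set is \<subseteq> {1..<n}" "word_product is = ?v" by auto
    with l i show ?thesis
      by (intro exI[of _ "is @ [i]"]) (simp add: word_product_snoc)
  qed
qed

lemma coxeter_length_eq:
  assumes "u \<in> Sym n"
  shows "coxeter_length n u = ilen n u"
  unfolding coxeter_length_def
proof (rule Least_equality)
  show "\<exists>is. length is = ilen n u \<and> set is \<subseteq> {1..<n} \<and> word_product is = u"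
    by (rule reduced_word[OF assms])
qed (use ilen_word_product in blast)

section \<open>The right weak order and inclusion of inversions\<close>

lemma weak_cover_iff:
  "weak_cover n x y \<longleftrightarrow> x \<in> Sym n \<and> (\<exists>i\<in>{1..<n}. x i < x (Suc i) \<and> y = x \<circ> simple_gen i)"
proof -
  have "coxeter_length n (x \<circ> simple_gen i) = coxeter_length n x + 1 \<longleftrightarrow> x i < x (Suc i)"
    if x: "x \<in> Sym n" and i: "i \<in> {1..<n}" for i
  proof -
    have "x \<circ> simple_gen i \<in> Sym n" using x i Sym_comp Sym_simple_gen by blast
    then have "coxeter_length n (x \<circ> simple_gen i) = ilen n (x \<circ> simple_gen i)"
      "coxeter_length n x = ilen n x"
      using x coxeter_length_eq by blast+
    moreover have "ilen n (x \<circ> simple_gen i) = ilen n x + 1 \<longleftrightarrow> x i < x (Suc i)"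
      using asc_or_desc[OF x, of i] ilen_simple_gen_up[OF x i] ilen_simple_gen_down[OF x i]
      by linarith
    ultimately show ?thesis by simp
  qed
  then show ?thesis unfolding weak_cover_def by blast
qed

lemma weak_coverE:
  assumes "weak_cover n x y"
  obtains i where "x \<in> Sym n" "i \<in> {1..<n}" "x i < x (Suc i)" "y = x \<circ> simple_gen i"
  using assms weak_cover_iff by auto

lemma weak_cover_Sym: "weak_cover n x y \<Longrightarrow> x \<in> Sym n \<and> y \<in> Sym n"
  unfolding weak_cover_def using Sym_comp Sym_simple_gen by blast

lemma weak_le_refl [simp]: "weak_le n x x"
  by (simp add: weak_le_def)

lemma weak_le_trans: "weak_le n x y \<Longrightarrow> weak_le n y z \<Longrightarrow> weak_le n x z"
  by (simp add: weak_le_def)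

lemma weak_cover_le: "weak_cover n x y \<Longrightarrow> weak_le n x y"
  by (simp add: weak_le_def)

lemma weak_cover_ilen: "weak_cover n x y \<Longrightarrow> ilen n y = ilen n x + 1"
  unfolding weak_cover_iff using ilen_simple_gen_up by blast

lemma weak_le_Sym: "weak_le n x y \<Longrightarrow> x \<in> Sym n \<Longrightarrow> y \<in> Sym n"
  unfolding weak_le_def by (induction rule: rtranclp_induct) (auto dest: weak_cover_Sym)

lemma weak_le_ilen:
  assumes "weak_le n x y"
  shows "x = y \<or> ilen n x < ilen n y"
  using assms unfolding weak_le_def
  by (induction rule: rtranclp_induct) (auto dest: weak_cover_ilen)

lemma weak_le_antisym: "weak_le n x y \<Longrightarrow> weak_le n y x \<Longrightarrow> x = y"
  using weak_le_ilen by (metis less_asym)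

text \<open>
  If \<open>x \<noteq> y\<close>, some descent of \<open>y\<close> exchanges two values that \<open>x\<close> has in their natural order: otherwise
  \<open>x\<^sup>-\<^sup>1y\<close> would be increasing, hence the identity. Undoing this descent keeps \<open>Inv x\<close> included, so
  one can walk down from \<open>y\<close> to \<open>x\<close>.
\<close>

lemma weak_le_if_Inv_subset:
  assumes "x \<in> Sym n" "y \<in> Sym n" "Inv n x \<subseteq> Inv n y"
  shows "weak_le n x y"
  using assms
proof (induction "ilen n y" arbitrary: y rule: less_induct)
  case less
  show ?case
  proof (cases "inv x \<circ> y = id")
    case True
    then have "x \<circ> (inv x \<circ> y) = x" by simp
    then have "y = x" using less.prems(1) by (simp flip: comp_assoc)
    then show ?thesis by simp
  next
    case False
    have z: "inv x \<circ> y \<in> Sym n" using less.prems Sym_comp Sym_inv by blast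
    from False obtain i where i: "i \<in> {1..<n}" "\<not> inv x (y i) < inv x (y (Suc i))"
      using id_or_descent[OF z] by auto
    have r: "y i \<in> {1..n}" "y (Suc i) \<in> {1..n}"
      using i(1) Sym_app_mem[OF less.prems(2), of i] Sym_app_mem[OF less.prems(2), of "Suc i"] by auto
    have xlt: "inv x (y (Suc i)) < inv x (y i)"
      using i(2) less.prems by (metis Sym_eq_iff Sym_inv_eq_iff linorder_neqE_nat n_not_Suc_n)
    have ylt: "y (Suc i) < y i"
    proof (rule ccontr)
      assume "\<not> ?thesis"
      then have "y i < y (Suc i)" using asc_or_desc[OF less.prems(2), of i] by blast
      then have "(y i, y (Suc i)) \<in> Inv n x" using r xlt by (simp add: Inv_iff)
      then have "(y i, y (Suc i)) \<in> Inv n y" using less.prems by blast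
      then show False using less.prems by (simp add: Inv_iff)
    qed
    let ?v = "y \<circ> simple_gen i"
    have v: "?v \<in> Sym n" using less.prems i Sym_comp Sym_simple_gen by blast
    have vlt: "?v i < ?v (Suc i)" using ylt by simp
    have ins: "Inv n y = insert (?v i, ?v (Suc i)) (Inv n ?v)"
      using Inv_simple_gen(1)[of ?v, OF v i(1) vlt] by (simp only: simple_gen_invol)
    have "(?v i, ?v (Suc i)) \<notin> Inv n x"
      using xlt by (simp add: Inv_iff)
    then have "Inv n x \<subseteq> Inv n ?v" using ins less.prems(3) by (metis subset_insert)
    moreover have "ilen n ?v < ilen n y" using ilen_simple_gen_down[OF less.prems(2) i(1) ylt] by simp
    ultimately have "weak_le n x ?v" using less.hyps less.prems v by blast
    moreover have "weak_cover n ?v y"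
      unfolding weak_cover_iff using v vlt i(1) by (metis simple_gen_invol)
    ultimately show ?thesis using weak_cover_le weak_le_trans by blast
  qed
qed

section \<open>The Bruhat order\<close>

text \<open>
  An edge of the Bruhat graph: the transposition may raise the length by more than one. These steps
  generate the same order as the covers, but they are stable under the operations used below.
\<close>

definition bruhat_up :: "nat \<Rightarrow> (nat \<Rightarrow> nat) \<Rightarrow> (nat \<Rightarrow> nat) \<Rightarrow> bool" where
  "bruhat_up n u v \<longleftrightarrow> u \<in> Sym n \<and>
     (\<exists>p\<in>{1..n}. \<exists>q\<in>{1..n}. p < q \<and> u p < u q \<and> v = u \<circ> Transposition.transpose p q)"

lemma bruhat_upI:
  assumes "u \<in> Sym n" "p \<in> {1..n}" "q \<in> {1..n}" "p < q" "u p < u q"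
  shows "bruhat_up n u (u \<circ> Transposition.transpose p q)"
  using assms unfolding bruhat_up_def by blast

lemma comp_transpose_Sym:
  "u \<in> Sym n \<Longrightarrow> p \<in> {1..n} \<Longrightarrow> q \<in> {1..n} \<Longrightarrow> u \<circ> Transposition.transpose p q \<in> Sym n"
  by (intro Sym_comp Sym_transpose)

lemma transpose_comp_Sym:
  "u \<in> Sym n \<Longrightarrow> p \<in> {1..n} \<Longrightarrow> q \<in> {1..n} \<Longrightarrow> Transposition.transpose p q \<circ> u \<in> Sym n"
  by (intro Sym_comp Sym_transpose)

lemma bruhat_up_Sym: "bruhat_up n u v \<Longrightarrow> u \<in> Sym n \<and> v \<in> Sym n"
  unfolding bruhat_up_def using comp_transpose_Sym by blast

lemma transpose_conj_simple_gen:
  assumes "Suc p < q"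
  shows "u \<circ> Transposition.transpose p q
    = u \<circ> simple_gen p \<circ> Transposition.transpose (Suc p) q \<circ> simple_gen p"
  using assms by (auto simp: fun_eq_iff simple_gen_def Transposition.transpose_def)

lemma transpose_conj:
  assumes "p < r" "r < (q::nat)"
  shows "u \<circ> Transposition.transpose p q
    = u \<circ> Transposition.transpose p r \<circ> Transposition.transpose r q \<circ> Transposition.transpose p r"
  using assms by (auto simp: fun_eq_iff Transposition.transpose_def)

text \<open>
  Conjugation by \<open>s\<^sub>p\<close> shortens the distance between the two positions. As the value at \<open>p + 1\<close> does
  not lie between the two exchanged values, one of the two outer steps raises the length and the other
  lowers it, so the net change is that of the shorter exchange.
\<close>

lemma ilen_transpose_cover:
  assumes "u \<in> Sym n" "1 \<le> p" "p < q" "q \<le> n" "u p < u q"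
    and "\<And>r. p < r \<Longrightarrow> r < q \<Longrightarrow> u r < u p \<or> u q < u r"
  shows "ilen n (u \<circ> Transposition.transpose p q) = ilen n u + 1"
  using assms
proof (induction "q - p" arbitrary: u p)
  case 0
  then show ?case by simp
next
  case (Suc d)
  show ?case
  proof (cases "q = Suc p")
    case True
    then show ?thesis
      using ilen_simple_gen_up[of u n p] Suc.prems by (simp add: simple_gen_def)
  next
    case False
    \<comment> \<open>The exchange of \<open>p\<close> and \<open>q\<close> goes through \<open>u, v, x\<close> and back by \<open>s\<^sub>p\<close>.\<close>
    define v where "v = u \<circ> simple_gen p"
    define x where "x = v \<circ> Transposition.transpose (Suc p) q"
    have lt: "Suc p < q" using False Suc.prems by simp
    have p: "p \<in> {1..<n}" using Suc.prems lt by simp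
    have v: "v \<in> Sym n" unfolding v_def by (intro Sym_comp Sym_simple_gen Suc.prems p)
    have x: "x \<in> Sym n" unfolding x_def using lt Suc.prems by (intro comp_transpose_Sym v) auto
    have vals: "v p = u (Suc p)" "v (Suc p) = u p" "v q = u q" "x p = u (Suc p)" "x (Suc p) = u q"
      and vr: "\<And>r. Suc p < r \<Longrightarrow> v r = u r"
      using lt by (auto simp: v_def x_def simple_gen_def Transposition.transpose_def)
    have eq: "u \<circ> Transposition.transpose p q = x \<circ> simple_gen p"
      unfolding x_def v_def using transpose_conj_simple_gen[OF lt] .
    have step: "ilen n x = ilen n v + 1"
      unfolding x_def
    proof (rule Suc.hyps(1))
      show "d = q - Suc p" using Suc.hyps(2) by simp
      show "v r < v (Suc p) \<or> v q < v r" if "Suc p < r" "r < q" for r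
        using Suc.prems(6)[of r] that by (simp add: vals vr)
    qed (use lt v Suc.prems vals in auto)
    consider "u (Suc p) < u p" | "u q < u (Suc p)" using Suc.prems(6)[of "Suc p"] lt by auto
    then show ?thesis
    proof cases
      case 1
      then have "ilen n u = ilen n v + 1"
        unfolding v_def using ilen_simple_gen_down[OF Suc.prems(1) p] by simp
      moreover have "ilen n (x \<circ> simple_gen p) = ilen n x + 1"
        using ilen_simple_gen_up[OF x p] vals 1 Suc.prems by simp
      ultimately show ?thesis using step eq by simp
    next
      case 2
      then have "ilen n v = ilen n u + 1"
        unfolding v_def using ilen_simple_gen_up[OF Suc.prems(1) p] Suc.prems by simp
      moreover have "ilen n x = ilen n (x \<circ> simple_gen p) + 1"
        using ilen_simple_gen_down[OF x p] vals 2 by simp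
      ultimately show ?thesis using step eq by simp
    qed
  qed
qed

text \<open>
  If no value at a position in between separates the exchanged values, the step is a cover. Otherwise
  such a position \<open>r\<close> splits the exchange of \<open>p\<close> and \<open>q\<close> into three exchanges over shorter distances,
  each of them raising the length, as in \<open>123, 213, 231, 321\<close>.
\<close>

lemma transpose_chain:
  assumes "u \<in> Sym n" "1 \<le> p" "p < q" "q \<le> n" "u p < u q"
  shows "bruhat_le n u (u \<circ> Transposition.transpose p q) \<and>
    ilen n u < ilen n (u \<circ> Transposition.transpose p q)"
  using assms
proof (induction "q - p" arbitrary: u p q rule: less_induct)
  case less
  let ?t = "u \<circ> Transposition.transpose p q"
  have pq: "p \<in> {1..n}" "q \<in> {1..n}" using less.prems by auto
  have t: "?t \<in> Sym n" using less.prems pq comp_transpose_Sym by blast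
  show ?case
  proof (cases "\<forall>r. p < r \<longrightarrow> r < q \<longrightarrow> u r < u p \<or> u q < u r")
    case True
    then have l: "ilen n ?t = ilen n u + 1"
      using less.prems by (intro ilen_transpose_cover) auto
    then have "coxeter_length n ?t = coxeter_length n u + 1"
      using coxeter_length_eq[OF t] coxeter_length_eq[OF less.prems(1)] by simp
    then have "bruhat_cover n u ?t"
      unfolding bruhat_cover_def
      using less.prems(1,3) pq by (intro conjI bexI[of _ p] bexI[of _ q]) simp_all
    with l show ?thesis by (simp add: bruhat_le_def)
  next
    case False
    then obtain r where r: "p < r" "r < q" "\<not> u r < u p" "\<not> u q < u r" by blast
    with less.prems(1) have b: "u p < u r" "u r < u q"
      using Sym_eq_iff[OF less.prems(1)] by (metis less_irrefl linorder_neqE_nat)+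
    define u1 where "u1 = u \<circ> Transposition.transpose p r"
    define u2 where "u2 = u1 \<circ> Transposition.transpose r q"
    have r': "r \<in> {1..n}" using r less.prems by simp
    have s1: "u1 \<in> Sym n" unfolding u1_def using r' pq less.prems comp_transpose_Sym by blast
    have s2: "u2 \<in> Sym n" unfolding u2_def using r' pq s1 comp_transpose_Sym by blast
    have vals: "u1 r = u p" "u1 q = u q" "u1 p = u r" "u2 p = u r" "u2 r = u q"
      using r by (auto simp: u1_def u2_def Transposition.transpose_def)
    have eq: "?t = u2 \<circ> Transposition.transpose p r"
      unfolding u2_def u1_def using transpose_conj[OF r(1,2)] .
    have "bruhat_le n u u1 \<and> ilen n u < ilen n u1"
      unfolding u1_def by (rule less.hyps) (use r less.prems b in auto)
    moreover have "bruhat_le n u1 u2 \<and> ilen n u1 < ilen n u2"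
      unfolding u2_def by (rule less.hyps) (use r less.prems b vals s1 in auto)
    moreover have "bruhat_le n u2 ?t \<and> ilen n u2 < ilen n ?t"
      unfolding eq by (rule less.hyps) (use r less.prems b vals s2 in auto)
    ultimately show ?thesis
      unfolding bruhat_le_def by (meson rtranclp_trans less_trans)
  qed
qed

lemma bruhat_upE:
  assumes "bruhat_up n u v"
  obtains p q where "u \<in> Sym n" "p \<in> {1..n}" "q \<in> {1..n}" "p < q" "u p < u q"
    "v = u \<circ> Transposition.transpose p q"
  using assms unfolding bruhat_up_def by blast

lemma bruhat_up_le: "bruhat_up n u v \<Longrightarrow> bruhat_le n u v"
  by (elim bruhat_upE) (simp add: transpose_chain)

lemma bruhat_up_ilen: "bruhat_up n u v \<Longrightarrow> ilen n u < ilen n v"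
  by (elim bruhat_upE) (simp add: transpose_chain)

lemma bruhat_cover_up:
  assumes "bruhat_cover n u v"
  shows "bruhat_up n u v"
proof -
  from assms obtain a b where u: "u \<in> Sym n" and ab: "a \<in> {1..n}" "b \<in> {1..n}" "a \<noteq> b"
    and v: "v = u \<circ> Transposition.transpose a b" and l: "coxeter_length n v = coxeter_length n u + 1"
    unfolding bruhat_cover_def by blast
  define p q where "p = min a b" and "q = max a b"
  have pq: "p \<in> {1..n}" "q \<in> {1..n}" "p < q" using ab by (auto simp: p_def q_def)
  have v': "v = u \<circ> Transposition.transpose p q"
    using v by (auto simp: p_def q_def min_def max_def transpose_commute)
  have vS: "v \<in> Sym n" using u ab v comp_transpose_Sym by blast
  have l': "ilen n v = ilen n u + 1" using l coxeter_length_eq u vS by metis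
  have "u p < u q"
  proof (rule ccontr)
    assume "\<not> ?thesis"
    then have "v p < v q" using pq u v' Sym_eq_iff[OF u, of p q] by simp
    then have "bruhat_up n v (v \<circ> Transposition.transpose p q)" using bruhat_upI vS pq by blast
    then have "ilen n v < ilen n (v \<circ> Transposition.transpose p q)" by (rule bruhat_up_ilen)
    also have "v \<circ> Transposition.transpose p q = u" by (simp add: v' comp_assoc)
    finally show False using l' by simp
  qed
  then show ?thesis using v' pq u bruhat_upI by blast
qed

lemma bruhat_le_iff_up: "bruhat_le n = (bruhat_up n)\<^sup>*\<^sup>*"
proof (intro ext iffI)
  fix u v
  show "(bruhat_up n)\<^sup>*\<^sup>* u v" if "bruhat_le n u v"
    using that unfolding bruhat_le_def by (rule rtranclp_mono[THEN predicate2D, rotated]) 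
      (use bruhat_cover_up in blast)
  show "bruhat_le n u v" if "(bruhat_up n)\<^sup>*\<^sup>* u v"
    using that
  proof induction
    case (step v w)
    then show ?case using bruhat_up_le[of n v w] unfolding bruhat_le_def by (meson rtranclp_trans)
  qed (simp add: bruhat_le_def)
qed

lemma bruhat_le_refl [simp]: "bruhat_le n u u"
  by (simp add: bruhat_le_def)

lemma bruhat_le_trans: "bruhat_le n u v \<Longrightarrow> bruhat_le n v x \<Longrightarrow> bruhat_le n u x"
  unfolding bruhat_le_def by (rule rtranclp_trans)

lemma bruhat_le_Sym:
  assumes "bruhat_le n u v"
  shows "u = v \<or> (u \<in> Sym n \<and> v \<in> Sym n)"
  using assms unfolding bruhat_le_iff_up
  by (induction rule: rtranclp_induct) (use bruhat_up_Sym in blast)+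

lemma bruhat_le_ilen:
  assumes "bruhat_le n u v"
  shows "u = v \<or> ilen n u < ilen n v"
  using assms unfolding bruhat_le_iff_up
  by (induction rule: rtranclp_induct) (auto dest: bruhat_up_ilen)

lemma bruhat_le_antisym: "bruhat_le n u v \<Longrightarrow> bruhat_le n v u \<Longrightarrow> u = v"
  using bruhat_le_ilen by (metis less_asym)

text \<open>
  The Bruhat step seen from the left: exchange two values that occur in their natural order.
\<close>

lemma bruhat_up_transpose_comp:
  assumes u: "u \<in> Sym n" and ab: "a \<in> {1..n}" "b \<in> {1..n}" "a < b" "inv u a < inv u b"
  shows "bruhat_up n u (Transposition.transpose a b \<circ> u)"
  unfolding transpose_comp_eq[OF u]
  using assms by (intro bruhat_upI Sym_app_mem[OF Sym_inv[OF u]]) auto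

lemma bruhat_up_inv:
  assumes "bruhat_up n u v"
  shows "bruhat_up n (inv u) (inv v)"
proof -
  from assms obtain p q where u: "u \<in> Sym n" and pq: "p \<in> {1..n}" "q \<in> {1..n}" "p < q" "u p < u q"
    and v: "v = u \<circ> Transposition.transpose p q"
    by (rule bruhat_upE)
  have "inv v = Transposition.transpose p q \<circ> inv u" using v inv_comp_transpose[OF u] by simp
  then show ?thesis using bruhat_up_transpose_comp[OF Sym_inv[OF u] pq(1-3)] u pq by simp
qed

lemma bruhat_le_inv:
  assumes "bruhat_le n u v"
  shows "bruhat_le n (inv u) (inv v)"
  using assms unfolding bruhat_le_iff_up
  by (induction rule: rtranclp_induct) (auto intro: rtranclp.rtrancl_into_rtrancl bruhat_up_inv)

text \<open>
  The shorter and the longer of \<open>x\<close> and \<open>x s\<^sub>i\<close>, that is, the ends of the coset of \<open>x\<close>.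
\<close>

definition down :: "nat \<Rightarrow> (nat \<Rightarrow> nat) \<Rightarrow> nat \<Rightarrow> nat" where
  "down i x = (if x i < x (Suc i) then x else x \<circ> simple_gen i)"

definition up :: "nat \<Rightarrow> (nat \<Rightarrow> nat) \<Rightarrow> nat \<Rightarrow> nat" where
  "up i x = (if x i < x (Suc i) then x \<circ> simple_gen i else x)"

lemma bruhat_up_simple_gen:
  assumes "x \<in> Sym n" "i \<in> {1..<n}" "x i < x (Suc i)"
  shows "bruhat_up n x (x \<circ> simple_gen i)"
  unfolding simple_gen_def using assms by (intro bruhat_upI) auto

lemma down_le:
  assumes "x \<in> Sym n" "i \<in> {1..<n}"
  shows "bruhat_le n (down i x) x"
proof (cases "x i < x (Suc i)")
  case False
  then have "x (Suc i) < x i" using asc_or_desc[OF assms(1), of i] by simp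
  moreover have "x \<circ> simple_gen i \<in> Sym n" using assms Sym_comp Sym_simple_gen by blast
  ultimately have "bruhat_up n (x \<circ> simple_gen i) (x \<circ> simple_gen i \<circ> simple_gen i)"
    using assms by (intro bruhat_up_simple_gen) auto
  with False show ?thesis by (simp only: down_def simple_gen_invol if_False bruhat_up_le)
qed (simp add: down_def)

lemma up_ge:
  assumes "x \<in> Sym n" "i \<in> {1..<n}"
  shows "bruhat_le n x (up i x)"
  using bruhat_up_simple_gen[OF assms] by (auto simp: up_def bruhat_up_le)

lemma down_up_simple_gen:
  assumes "x \<in> Sym n" "i \<in> {1..<n}"
  shows "down i (x \<circ> simple_gen i) = down i x" "up i (x \<circ> simple_gen i) = up i x"
  using asc_or_desc[OF assms(1), of i] by (auto simp: down_def up_def)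

text \<open>
  Unless the step is multiplication by \<open>s\<^sub>i\<close> itself, conjugating its transposition by \<open>s\<^sub>i\<close> does not
  reverse the two positions. So \<open>x s\<^sub>i\<close> and \<open>y s\<^sub>i\<close> again form a step, and the shorter (longer) ones of
  both pairs compare as required. This is the lifting property of the Bruhat order.
\<close>

lemma down_up_mono_step:
  assumes "bruhat_up n x y" and i: "i \<in> {1..<n}"
  shows "bruhat_le n (down i x) (down i y) \<and> bruhat_le n (up i x) (up i y)"
proof -
  from assms(1) obtain p q where x: "x \<in> Sym n" and pq: "p \<in> {1..n}" "q \<in> {1..n}" "p < q" "x p < x q"
    and y: "y = x \<circ> Transposition.transpose p q"
    by (rule bruhat_upE)
  have yS: "y \<in> Sym n" using bruhat_up_Sym assms by blast
  show ?thesis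
  proof (cases "{p, q} = {i, Suc i}")
    case True
    then have "p = i" "q = Suc i" using pq by (auto simp: doubleton_eq_iff)
    then have "y = x \<circ> simple_gen i" using y by (simp add: simple_gen_def)
    then show ?thesis using down_up_simple_gen[OF x i] by simp
  next
    case False
    let ?s = "simple_gen i"
    have s: "?s \<in> Sym n" using Sym_simple_gen i by blast
    have ss: "?s (?s k) = k" for k by (simp add: simple_gen_def)
    have "x \<circ> ?s \<circ> Transposition.transpose (?s p) (?s q)
        = x \<circ> (Transposition.transpose p q \<circ> ?s)"
      using comp_transpose_eq[OF s, of "?s p" "?s q"] by (simp only: comp_assoc ss)
    then have eq: "y \<circ> ?s = x \<circ> ?s \<circ> Transposition.transpose (?s p) (?s q)"
      using y by (simp only: comp_assoc)
    have "?s p < ?s q" using simple_gen_less[of p q i] False pq by simp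
    then have "bruhat_up n (x \<circ> ?s) (y \<circ> ?s)"
      unfolding eq using pq ss by (intro bruhat_upI Sym_comp x s Sym_app_mem[OF s]) auto
    then have 1: "bruhat_le n (x \<circ> ?s) (y \<circ> ?s)" by (rule bruhat_up_le)
    have 2: "bruhat_le n x y" using assms by (simp add: bruhat_up_le)
    have "bruhat_le n (down i x) (down i y)"
    proof (cases "y i < y (Suc i)")
      case True
      then show ?thesis using down_le[OF x i] 2 bruhat_le_trans by (auto simp: down_def)
    next
      case False
      have "bruhat_le n (down i x) (x \<circ> ?s)"
        using down_le[OF Sym_comp[OF x s] i] by (simp only: down_up_simple_gen(1)[OF x i])
      then show ?thesis using 1 False bruhat_le_trans by (auto simp: down_def[of i y])
    qed
    moreover have "bruhat_le n (up i x) (up i y)"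
    proof (cases "x i < x (Suc i)")
      case False
      then show ?thesis using up_ge[OF yS i] 2 bruhat_le_trans by (auto simp: up_def[of i x])
    next
      case True
      have "bruhat_le n (y \<circ> ?s) (up i y)"
        using up_ge[OF Sym_comp[OF yS s] i] by (simp only: down_up_simple_gen(2)[OF yS i])
      then show ?thesis using 1 True bruhat_le_trans by (auto simp: up_def[of i x])
    qed
    ultimately show ?thesis ..
  qed
qed

lemma down_up_mono:
  assumes "bruhat_le n x y" and i: "i \<in> {1..<n}"
  shows "bruhat_le n (down i x) (down i y)" "bruhat_le n (up i x) (up i y)"
proof -
  have "bruhat_le n (down i x) (down i y) \<and> bruhat_le n (up i x) (up i y)"
    using assms(1)[unfolded bruhat_le_iff_up]
  proof (induction rule: rtranclp_induct)
    case (step y z)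
    then show ?case using down_up_mono_step[OF _ i, of y z] bruhat_le_trans by blast
  qed simp
  then show "bruhat_le n (down i x) (down i y)" "bruhat_le n (up i x) (up i y)" by auto
qed

lemma descent_exists:
  assumes "u \<in> Sym n" "u \<noteq> id"
  obtains i where "i \<in> {1..<n}" "u (Suc i) < u i"
  using id_or_descent[OF assms(1)] asc_or_desc[OF assms(1)] assms(2) by metis

lemma id_bruhat_le:
  assumes "u \<in> Sym n"
  shows "bruhat_le n id u"
  using assms
proof (induction "ilen n u" arbitrary: u rule: less_induct)
  case less
  show ?case
  proof (cases "u = id")
    case False
    then obtain i where i: "i \<in> {1..<n}" "u (Suc i) < u i" using descent_exists less.prems by blast
    then have "down i u = u \<circ> simple_gen i" by (simp add: down_def)
    moreover have "ilen n (u \<circ> simple_gen i) < ilen n u"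
      using ilen_simple_gen_down[OF less.prems, of i] i by simp
    moreover have "u \<circ> simple_gen i \<in> Sym n" using Sym_comp Sym_simple_gen i less.prems by blast
    ultimately show ?thesis using less.hyps down_le[OF less.prems i(1)] bruhat_le_trans by metis
  qed simp
qed

section \<open>The vertex of a chamber\<close>

text \<open>
  If \<open>w\<close> has a descent at \<open>i\<close> and \<open>w' = w s\<^sub>i\<close>, then \<open>[e,w]\<close> consists of \<open>[e,w']\<close> and its right translate
  by \<open>s\<^sub>i\<close>. When \<open>m\<close> is the minimum of \<open>y[e,w']\<close>, the shorter one of \<open>m\<close> and \<open>m s\<^sub>i\<close> is the minimum of
  \<open>y[e,w]\<close>, because \<open>down\<close> is monotone. The minimum is a downward variant of the Demazure product of
  \<open>y\<close> and \<open>w\<close>.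
\<close>

lemma lower_has_min:
  assumes "w \<in> Sym n" "y \<in> Sym n"
  shows "\<exists>u\<in>bruhat_lower n w. \<forall>v\<in>bruhat_lower n w. bruhat_le n (y \<circ> u) (y \<circ> v)"
  using assms(1)
proof (induction "ilen n w" arbitrary: w rule: less_induct)
  case less
  show ?case
  proof (cases "w = id")
    case True
    have "bruhat_lower n id = {id}"
      using bruhat_le_ilen[of n _ id] ilen_id[of n] by (auto simp: bruhat_lower_def Sym_id)
    then show ?thesis unfolding True by simp
  next
    case False
    then obtain i where i: "i \<in> {1..<n}" "w (Suc i) < w i" using descent_exists less.prems by blast
    let ?s = "simple_gen i" let ?w = "w \<circ> ?s"
    have s: "?s \<in> Sym n" using i Sym_simple_gen by blast
    have w': "?w \<in> Sym n" using s less.prems Sym_comp by blast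
    have dw: "down i w = ?w" and uw: "up i ?w = w" using i by (auto simp: down_def up_def)
    have "ilen n ?w < ilen n w" using ilen_simple_gen_down[OF less.prems, of i] i by simp
    from less.hyps[OF this w'] obtain u where u: "u \<in> bruhat_lower n ?w"
      and min: "\<And>v. v \<in> bruhat_lower n ?w \<Longrightarrow> bruhat_le n (y \<circ> u) (y \<circ> v)" by blast
    have uS: "u \<in> Sym n" and ule: "bruhat_le n u ?w" using u by (auto simp: bruhat_lower_def)
    have yu: "y \<circ> u \<in> Sym n" using assms(2) uS Sym_comp by blast
    \<comment> \<open>The coset of \<open>u\<close> lies below \<open>w\<close> as a whole.\<close>
    have uu: "bruhat_le n (up i u) w" using down_up_mono(2)[OF ule i(1)] uw by simp
    have us: "bruhat_le n (u \<circ> ?s) w"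
      using up_ge[OF Sym_comp[OF uS s] i(1)] uu bruhat_le_trans
      unfolding down_up_simple_gen(2)[OF uS i(1)] by blast
    have u1: "bruhat_le n u w" using up_ge[OF uS i(1)] uu bruhat_le_trans by blast
    \<comment> \<open>Chosen so that \<open>y \<circ> u'\<close> is the shorter element of its coset.\<close>
    define u' where "u' = (if (y \<circ> u) i < (y \<circ> u) (Suc i) then u else u \<circ> ?s)"
    have "u' \<in> bruhat_lower n w"
      using us u1 uS s Sym_comp by (simp add: u'_def bruhat_lower_def)
    moreover have yu': "y \<circ> u' = down i (y \<circ> u)"
      by (simp add: u'_def down_def comp_assoc)
    moreover have "bruhat_le n (down i (y \<circ> u)) (y \<circ> v)" if "v \<in> bruhat_lower n w" for v
    proof -
      have vS: "v \<in> Sym n" and vle: "bruhat_le n v w" using that by (auto simp: bruhat_lower_def)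
      have yv: "y \<circ> v \<in> Sym n" using assms(2) vS Sym_comp by blast
      have "bruhat_le n (down i v) ?w" using down_up_mono(1)[OF vle i(1)] dw by simp
      then have "down i v \<in> bruhat_lower n ?w"
        using vS s Sym_comp by (simp add: bruhat_lower_def down_def)
      then have "bruhat_le n (y \<circ> u) (y \<circ> down i v)" by (rule min)
      then have "bruhat_le n (down i (y \<circ> u)) (down i (y \<circ> down i v))"
        by (rule down_up_mono(1)[OF _ i(1)])
      also have "down i (y \<circ> down i v) = down i (y \<circ> v)"
      proof (cases "v i < v (Suc i)")
        case False
        then have "y \<circ> down i v = (y \<circ> v) \<circ> ?s" by (simp add: down_def comp_assoc)
        then show ?thesis using down_up_simple_gen(1)[OF yv i(1)] by simp
      qed (simp add: down_def)
      finally show ?thesis using down_le[OF yv i(1)] bruhat_le_trans by blast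
    qed
    ultimately show ?thesis by metis
  qed
qed

locale bruhat_interval =
  fixes n :: nat and w :: "nat \<Rightarrow> nat"
  assumes w: "w \<in> Sym n"
begin

abbreviation "lower \<equiv> bruhat_lower n w"

text \<open>
  The element \<open>inv u \<circ> y\<close> is the inverse of \<open>y\<^sup>-\<^sup>1u\<close>. As inversion preserves the Bruhat order, the
  minimum may be taken on this side, where crossing a wall of the chamber \<open>y\<close> is multiplication by
  \<open>s\<^sub>i\<close> on the right.
\<close>

definition vertex :: "(nat \<Rightarrow> nat) \<Rightarrow> nat \<Rightarrow> nat" where
  "vertex y = (THE u. u \<in> lower \<and> (\<forall>v\<in>lower. bruhat_le n (inv u \<circ> y) (inv v \<circ> y)))"

lemma lower_Sym: "u \<in> lower \<Longrightarrow> u \<in> Sym n"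
  by (simp add: bruhat_lower_def)

lemma finite_lower: "finite lower"
  using finite_Sym finite_subset[of lower "Sym n"] lower_Sym by blast

lemma lower_down: "u \<in> lower \<Longrightarrow> bruhat_up n v u \<Longrightarrow> v \<in> lower"
  using bruhat_up_Sym bruhat_up_le bruhat_le_trans unfolding bruhat_lower_def by blast

lemma vertex_eqI:
  assumes y: "y \<in> Sym n" and u: "u \<in> lower"
    and min: "\<And>v. v \<in> lower \<Longrightarrow> bruhat_le n (inv u \<circ> y) (inv v \<circ> y)"
  shows "vertex y = u"
  unfolding vertex_def
proof (rule the_equality)
  fix v
  assume v: "v \<in> lower \<and> (\<forall>u\<in>lower. bruhat_le n (inv v \<circ> y) (inv u \<circ> y))"
  then have "inv v \<circ> y = inv u \<circ> y" using u min bruhat_le_antisym by blast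
  then show "v = u" using comp_cancel[OF _ _ y] u v lower_Sym by blast
qed (use assms in blast)

lemma vertex_minimal:
  assumes y: "y \<in> Sym n"
  shows vertex_mem: "vertex y \<in> lower"
    and vertex_min: "\<And>v. v \<in> lower \<Longrightarrow> bruhat_le n (inv (vertex y) \<circ> y) (inv v \<circ> y)"
proof -
  obtain u where u: "u \<in> lower" and min: "\<And>v. v \<in> lower \<Longrightarrow> bruhat_le n (inv y \<circ> u) (inv y \<circ> v)"
    using lower_has_min[OF w Sym_inv[OF y]] by blast
  have "inv (inv y \<circ> v) = inv v \<circ> y" if "v \<in> lower" for v
    using that y lower_Sym Sym_inv inv_comp_Sym by (metis Sym_inv_app(5))
  then have "bruhat_le n (inv u \<circ> y) (inv v \<circ> y)" if "v \<in> lower" for v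
    using that min[THEN bruhat_le_inv] u by metis
  with vertex_eqI[OF y u] u show "vertex y \<in> lower"
    "\<And>v. v \<in> lower \<Longrightarrow> bruhat_le n (inv (vertex y) \<circ> y) (inv v \<circ> y)" by simp_all
qed

lemma vertex_Sym: "y \<in> Sym n \<Longrightarrow> vertex y \<in> Sym n"
  using vertex_mem lower_Sym by blast

lemma vertex_fixed: "u \<in> lower \<Longrightarrow> vertex u = u"
  by (rule vertex_eqI) (auto dest!: lower_Sym intro!: id_bruhat_le Sym_comp Sym_inv)

text \<open>
  Let \<open>a < b\<close> be inverted in \<open>u = vertex y\<close>. Then \<open>(a b)u\<close> is shorter than \<open>u\<close>, hence below \<open>w\<close>, and if
  \<open>y\<close> had \<open>a\<close> before \<open>b\<close>, it would beat the minimality of \<open>u\<close>.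
\<close>

lemma vertex_inversions:
  assumes y: "y \<in> Sym n"
  shows "Inv n (vertex y) \<subseteq> Inv n y"
proof
  fix ab assume ab: "ab \<in> Inv n (vertex y)"
  define u where "u = vertex y"
  obtain a b where [simp]: "ab = (a, b)" by force
  have a: "a \<in> {1..n}" "b \<in> {1..n}" "a < b" "inv u b < inv u a"
    using ab by (auto simp: Inv_iff u_def)
  have u: "u \<in> Sym n" "u \<in> lower" using vertex_Sym vertex_mem y by (auto simp: u_def)
  define v where "v = Transposition.transpose a b \<circ> u"
  have v: "v \<in> Sym n" unfolding v_def using a u transpose_comp_Sym by blast
  have iv: "inv v = inv u \<circ> Transposition.transpose a b" unfolding v_def using inv_transpose_comp[OF u(1)] .
  have "bruhat_up n v (Transposition.transpose a b \<circ> v)"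
    using a iv by (intro bruhat_up_transpose_comp v) auto
  then have "v \<in> lower" using lower_down u(2) by (simp add: v_def flip: comp_assoc)
  then have le: "bruhat_le n (inv u \<circ> y) (inv v \<circ> y)" using vertex_min[OF y] by (simp add: u_def)
  have "inv y b < inv y a"
  proof (rule ccontr)
    assume "\<not> ?thesis"
    then have lt: "inv y a < inv y b" using a Sym_inv_eq_iff[OF y, of a b] by simp
    have pq: "inv y a \<in> {1..n}" "inv y b \<in> {1..n}" using a Sym_app_mem[OF Sym_inv[OF y]] by auto
    have k: "inv v \<circ> y \<in> Sym n" using v y Sym_comp Sym_inv by blast
    have "bruhat_up n (inv v \<circ> y) (inv v \<circ> y \<circ> Transposition.transpose (inv y a) (inv y b))"
      using a y by (intro bruhat_upI k pq lt) (simp add: iv)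
    also have "inv v \<circ> y \<circ> Transposition.transpose (inv y a) (inv y b) = inv u \<circ> y"
      by (simp only: comp_assoc transpose_comp_eq[OF y, symmetric] iv) (simp flip: comp_assoc)
    finally have "ilen n (inv v \<circ> y) < ilen n (inv u \<circ> y)" by (rule bruhat_up_ilen)
    with bruhat_le_ilen[OF le] show False by auto
  qed
  then show "ab \<in> Inv n y" using a by (simp add: Inv_iff)
qed

text \<open>
  Let \<open>k\<close> and \<open>k'\<close> be the minima that define the vertices of \<open>y\<close> and \<open>y s\<^sub>i\<close>. The two families that
  they minimise are translates of each other by \<open>s\<^sub>i\<close>, and \<open>k < k s\<^sub>i\<close>. So lifting gives
  \<open>k \<le> k' \<le> k s\<^sub>i\<close>, and these ends differ by one in length. The first possibility means
  \<open>vertex (y s\<^sub>i) = (a b)u\<close>, the second means that the vertex stays.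
\<close>

lemma vertex_step:
  assumes y: "y \<in> Sym n" and i: "i \<in> {1..<n}" and lt: "y i < y (Suc i)"
  defines "t \<equiv> Transposition.transpose (y i) (y (Suc i))"
  shows vertex_step_order: "inv (vertex y) (y i) < inv (vertex y) (y (Suc i))"
    and vertex_step_eq: "vertex (y \<circ> simple_gen i) = (if t \<circ> vertex y \<in> lower then t \<circ> vertex y else vertex y)"
proof -
  define u where "u = vertex y"
  define s where "s = simple_gen i"
  define v where "v = vertex (y \<circ> s)"
  have s: "s \<in> Sym n" unfolding s_def using i Sym_simple_gen by blast
  have ys: "y \<circ> s \<in> Sym n" using y s Sym_comp by blast
  have u: "u \<in> lower" "u \<in> Sym n" using vertex_Sym vertex_mem y by (auto simp: u_def)
  have v: "v \<in> lower" "v \<in> Sym n" using vertex_Sym vertex_mem ys by (auto simp: v_def)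
  have i': "i \<in> {1..n}" "Suc i \<in> {1..n}" using i by auto
  have r: "y i \<in> {1..n}" "y (Suc i) \<in> {1..n}" using Sym_app_mem[OF y] i' by auto
  have "(y i, y (Suc i)) \<notin> Inv n y" using y by (simp add: Inv_iff)
  then have "(y i, y (Suc i)) \<notin> Inv n u" using vertex_inversions[OF y] unfolding u_def by blast
  then have ord: "inv u (y i) < inv u (y (Suc i))"
    using r lt Sym_inv_eq_iff[OF u(2), of "y i" "y (Suc i)"] by (simp add: Inv_iff)
  then show "inv (vertex y) (y i) < inv (vertex y) (y (Suc i))" by (simp add: u_def)
  have sS: "x \<circ> s \<circ> s = x" for x :: "nat \<Rightarrow> nat" by (simp add: s_def)
  define k where "k = inv u \<circ> y"
  define k' where "k' = inv v \<circ> y \<circ> s"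
  have k: "k \<in> Sym n" unfolding k_def by (intro Sym_comp Sym_inv u y)
  have k': "k' \<in> Sym n" unfolding k'_def by (intro Sym_comp Sym_inv v y s)
  have klt: "k i < k (Suc i)" using ord by (simp add: k_def)
  \<comment> \<open>The candidate \<open>t \<circ> u\<close> realises \<open>k\<close> in the chamber \<open>y s\<^sub>i\<close>.\<close>
  have tk: "inv (t \<circ> u) \<circ> (y \<circ> s) = k"
  proof -
    have "inv (t \<circ> u) = inv u \<circ> t" unfolding t_def by (rule inv_transpose_comp[OF u(2)])
    moreover have "t \<circ> y = y \<circ> s"
      unfolding t_def s_def simple_gen_def using comp_transpose_eq[OF y, of i "Suc i"] by simp
    ultimately have "inv (t \<circ> u) \<circ> (y \<circ> s) = inv u \<circ> t \<circ> (t \<circ> y)" by simp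
    also have "\<dots> = inv u \<circ> (t \<circ> t) \<circ> y" by (simp only: comp_assoc)
    finally show ?thesis by (simp add: t_def k_def)
  qed
  have "bruhat_le n k (k' \<circ> s)"
    using vertex_min[OF y v(1)] by (simp only: k_def k'_def sS u_def)
  then have "bruhat_le n (down i k) (down i (k' \<circ> s))" by (rule down_up_mono(1)[OF _ i])
  then have "bruhat_le n k (down i k')"
    using klt down_up_simple_gen(1)[OF k' i] by (simp add: down_def[of i k] s_def)
  then have lo: "bruhat_le n k k'" using down_le[OF k' i] bruhat_le_trans by blast
  have hi: "bruhat_le n k' (k \<circ> s)"
    using vertex_min[OF ys u(1)] by (simp only: k_def k'_def v_def comp_assoc)
  have tS: "t \<circ> u \<in> Sym n" unfolding t_def by (rule transpose_comp_Sym[OF u(2) r])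
  have vk: "v = t \<circ> u" if "k' = k"
    by (rule comp_cancel[OF v(2) tS ys]) (use that tk in \<open>simp only: k'_def comp_assoc\<close>)
  have vks: "v = u" if "k' = k \<circ> s"
    by (rule comp_cancel[OF v(2) u(2) ys]) (use that in \<open>simp only: k'_def k_def comp_assoc\<close>)
  have "v = (if t \<circ> u \<in> lower then t \<circ> u else u)"
  proof (cases "t \<circ> u \<in> lower")
    case True
    then have "bruhat_le n k' k"
      using vertex_min[OF ys True] tk by (simp only: k'_def v_def comp_assoc)
    with lo have "k' = k" by (rule bruhat_le_antisym[symmetric])
    with True vk show ?thesis by simp
  next
    case False
    then have "k' \<noteq> k" using vk v by auto
    then have "ilen n k < ilen n k'" using bruhat_le_ilen[OF lo] by auto
    moreover have "ilen n (k \<circ> s) = ilen n k + 1"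
      unfolding s_def using ilen_simple_gen_up[OF k i] klt by simp
    ultimately have "k' = k \<circ> s" using bruhat_le_ilen[OF hi] by auto
    with False vks show ?thesis by simp
  qed
  then show "vertex (y \<circ> simple_gen i) = (if t \<circ> vertex y \<in> lower then t \<circ> vertex y else vertex y)"
    by (simp add: v_def u_def s_def)
qed

end

section \<open>Rank two intervals and tops of classes\<close>

lemma simple_gen_commute:
  assumes "i \<noteq> Suc j" "j \<noteq> Suc i"
  shows "x \<circ> simple_gen i \<circ> simple_gen j = x \<circ> simple_gen j \<circ> simple_gen i"
  using assms by (auto simp: fun_eq_iff simple_gen_def Transposition.transpose_def)

lemma simple_gen_braid:
  "x \<circ> simple_gen i \<circ> simple_gen (Suc i) \<circ> simple_gen i
    = x \<circ> simple_gen (Suc i) \<circ> simple_gen i \<circ> simple_gen (Suc i)"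
  by (auto simp: fun_eq_iff simple_gen_def Transposition.transpose_def)

lemma weak_le_simple_gen:
  assumes "x \<in> Sym n" "i \<in> {1..<n}" "x i < x (Suc i)"
  shows "weak_le n x (x \<circ> simple_gen i)"
  using assms by (intro weak_cover_le) (auto simp: weak_cover_iff)

lemma weak_le_first_step:
  assumes "weak_le n x z" "x \<noteq> z"
  shows "\<exists>i\<in>{1..<n}. x i < x (Suc i) \<and> weak_le n (x \<circ> simple_gen i) z"
  using assms(1)[unfolded weak_le_def]
proof (cases rule: converse_rtranclpE)
  case base
  then show ?thesis using assms(2) by simp
next
  case (step y)
  from step(1) obtain i where "i \<in> {1..<n}" "x i < x (Suc i)" "y = x \<circ> simple_gen i"
    by (rule weak_coverE)
  then show ?thesis using step(2) unfolding weak_le_def by (intro bexI[of _ i]) simp_all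
qed

text \<open>
  Relations in the symmetric group on three values, in the forms in which \<open>vertex_polygon\<close> compares
  the candidates for a new vertex with one fixed permutation.
\<close>

lemma transpose_three:
  assumes "a \<noteq> b" "b \<noteq> c" "a \<noteq> c"
  shows "Transposition.transpose a c \<circ> (Transposition.transpose a b \<circ> u)
      = Transposition.transpose a b \<circ> (Transposition.transpose b c \<circ> u)"
    and "Transposition.transpose b c \<circ> (Transposition.transpose a b \<circ> u)
      = Transposition.transpose a c \<circ> (Transposition.transpose b c \<circ> u)"
    and "Transposition.transpose a c \<circ> u
      = Transposition.transpose a b \<circ> (Transposition.transpose a c \<circ> (Transposition.transpose b c \<circ> u))"
    and "Transposition.transpose a c \<circ> u
      = Transposition.transpose b c \<circ> (Transposition.transpose a c \<circ> (Transposition.transpose a b \<circ> u))"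
  using assms by (auto simp: fun_eq_iff Transposition.transpose_def)

context bruhat_interval
begin

lemma vertex_weak_le: "y \<in> Sym n \<Longrightarrow> weak_le n (vertex y) y"
  using weak_le_if_Inv_subset vertex_Sym vertex_inversions by blast

text \<open>
  The way in which a candidate is excluded: it lies above something that is not below \<open>w\<close>.
\<close>

lemma not_lower_up:
  assumes "v \<notin> lower" "v \<in> Sym n" "a \<in> {1..n}" "b \<in> {1..n}" "a < b" "inv v a < inv v b"
  shows "Transposition.transpose a b \<circ> v \<notin> lower"
  using assms bruhat_up_transpose_comp lower_down by blast

lemma vertex_weak_cover:
  assumes "weak_cover n y z"
  shows "vertex z = vertex y \<or> ilen n (vertex y) < ilen n (vertex z)"
proof -
  obtain i where y: "y \<in> Sym n" and i: "i \<in> {1..<n}" "y i < y (Suc i)" and z: "z = y \<circ> simple_gen i"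
    using assms by (rule weak_coverE)
  let ?t = "Transposition.transpose (y i) (y (Suc i))"
  have "y i \<in> {1..n}" "y (Suc i) \<in> {1..n}" using i Sym_app_mem[OF y, of i] Sym_app_mem[OF y, of "Suc i"] by auto
  then have "bruhat_up n (vertex y) (?t \<circ> vertex y)"
    using bruhat_up_transpose_comp[OF vertex_Sym[OF y]] vertex_step_order[OF y i] i(2) by blast
  then show ?thesis using vertex_step_eq[OF y i] bruhat_up_ilen by (auto simp: z)
qed

lemma vertex_mono:
  assumes "weak_le n y z"
  shows "vertex z = vertex y \<or> ilen n (vertex y) < ilen n (vertex z)"
  using assms unfolding weak_le_def
proof (induction rule: rtranclp_induct)
  case (step x z)
  then show ?case using vertex_weak_cover[of x z] by auto
qed simp

lemma vertex_convex:
  assumes "weak_le n x z" "weak_le n z y" "vertex x = vertex y"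
  shows "vertex z = vertex x"
  using vertex_mono[OF assms(1)] vertex_mono[OF assms(2)] assms(3) by auto

text \<open>
  Let \<open>u = vertex x\<close>. That \<open>x s\<^sub>j\<close> stays in the class of \<open>x\<close> means that \<open>g\<close>, which is \<open>u\<close> with the two
  values at \<open>j\<close> and \<open>j + 1\<close> in \<open>x\<close> exchanged, is not below \<open>w\<close>. Along the path from \<open>x s\<^sub>i\<close> to the join, every
  new candidate for the vertex is \<open>g\<close> or lies above \<open>g\<close>, so none is admitted. The join is reached in one step
  for commuting generators and in two steps otherwise; then the three values \<open>a < b < c\<close> involved
  occur in this order in \<open>u\<close>, and the cases differ in whether \<open>g\<close> exchanges \<open>b, c\<close> or \<open>a, b\<close>.
\<close>

lemma vertex_polygon:
  assumes x: "x \<in> Sym n" and i: "i \<in> {1..<n}" "x i < x (Suc i)"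
    and j: "j \<in> {1..<n}" "x j < x (Suc j)" and ij: "i \<noteq> j"
    and fix_j: "vertex (x \<circ> simple_gen j) = vertex x"
  shows "\<exists>z. weak_le n (x \<circ> simple_gen i) z \<and> weak_le n (x \<circ> simple_gen j) z \<and>
    vertex z = vertex (x \<circ> simple_gen i)"
proof -
  let ?T = Transposition.transpose
  let ?s = simple_gen
  define u where "u = vertex x"
  define v where "v = vertex (x \<circ> ?s i)"
  have svi: "vertex (x \<circ> ?s i) = v" by (simp add: v_def)
  define g where "g = ?T (x j) (x (Suc j)) \<circ> u"
  have u: "u \<in> Sym n" "u \<in> lower" using vertex_Sym vertex_mem x by (auto simp: u_def)
  have r: "x k \<in> {1..n}" if "k \<in> {1..n}" for k using Sym_app_mem[OF x that] .
  have ir: "i \<in> {1..n}" "Suc i \<in> {1..n}" "j \<in> {1..n}" "Suc j \<in> {1..n}" using i j by auto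
  have g: "g \<in> Sym n" unfolding g_def by (intro transpose_comp_Sym u r ir)
  have gL: "g \<notin> lower"
  proof
    assume "g \<in> lower"
    then have "g = u" using vertex_step_eq[OF x j] fix_j by (simp add: g_def u_def)
    then have "g (inv u (x j)) = u (inv u (x j))" by simp
    then show False using u(1) j(2) by (simp add: g_def)
  qed
  have gi: "inv g k = inv u (?T (x j) (x (Suc j)) k)" for k
    unfolding g_def using inv_transpose_comp[OF u(1)] by simp
  have v_cases: "v = u \<or> v = ?T (x i) (x (Suc i)) \<circ> u"
    using vertex_step_eq[OF x i] by (auto simp: v_def u_def)
  have oi: "inv u (x i) < inv u (x (Suc i))" using vertex_step_order[OF x i] by (simp add: u_def)
  have oj: "inv u (x j) < inv u (x (Suc j))" using vertex_step_order[OF x j] by (simp add: u_def)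
  have sS: "?s i \<in> Sym n" "?s j \<in> Sym n" using Sym_simple_gen i j by blast+
  have stay: "vertex (y \<circ> ?s k) = v"
    if "y \<in> Sym n" "k \<in> {1..<n}" "y k < y (Suc k)" "vertex y = v" "?T (y k) (y (Suc k)) \<circ> v \<notin> lower" for y k
    using vertex_step_eq[OF that(1-3)] that(4,5) by simp
  have si: "x \<circ> ?s i \<in> Sym n" and sj: "x \<circ> ?s j \<in> Sym n" using sS x Sym_comp by blast+
  consider (comm) "i \<noteq> Suc j" "j \<noteq> Suc i" | (right) "j = Suc i" | (left) "i = Suc j" by blast
  then show ?thesis
  proof cases
    case comm
    have vals: "(x \<circ> ?s i) j = x j" "(x \<circ> ?s i) (Suc j) = x (Suc j)"
      "(x \<circ> ?s j) i = x i" "(x \<circ> ?s j) (Suc i) = x (Suc i)"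
      using comm ij by (auto simp: simple_gen_def Transposition.transpose_def)
    have ne: "x i \<noteq> x j" "x i \<noteq> x (Suc j)" "x (Suc i) \<noteq> x j" "x (Suc i) \<noteq> x (Suc j)"
      using comm ij by (auto simp: Sym_eq_iff[OF x])
    have b1: "?T (x j) (x (Suc j)) \<circ> v \<notin> lower"
    proof (cases "v = u")
      case True
      then show ?thesis using gL by (simp add: g_def)
    next
      case False
      have "?T (x i) (x (Suc i)) \<circ> g \<notin> lower"
        using ne oi by (intro not_lower_up gL g r ir i(2)) (auto simp: gi Transposition.transpose_def)
      also have "?T (x i) (x (Suc i)) \<circ> g = ?T (x j) (x (Suc j)) \<circ> (?T (x i) (x (Suc i)) \<circ> u)"
        using ne by (auto simp: g_def fun_eq_iff Transposition.transpose_def)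
      finally show ?thesis using False v_cases by metis
    qed
    have "vertex (x \<circ> ?s i \<circ> ?s j) = v"
      by (rule stay[OF si]) (use j vals b1 svi in auto)
    moreover have "weak_le n (x \<circ> ?s i) (x \<circ> ?s i \<circ> ?s j)"
      using vals j by (intro weak_le_simple_gen si) auto
    moreover have "weak_le n (x \<circ> ?s j) (x \<circ> ?s j \<circ> ?s i)"
      using vals i by (intro weak_le_simple_gen sj) auto
    ultimately show ?thesis
      using simple_gen_commute[OF comm, of x] svi by (intro exI[of _ "x \<circ> ?s i \<circ> ?s j"]) simp
  next
    case right
    define a b c where "a = x i" and "b = x j" and "c = x (Suc j)"
    have ab: "a < b" "b < c" using i j right by (auto simp: a_def b_def c_def)
    have abc: "a \<in> {1..n}" "b \<in> {1..n}" "c \<in> {1..n}" unfolding a_def b_def c_def by (intro r ir)+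
    have geq: "g = ?T b c \<circ> u" by (simp add: g_def b_def c_def)
    have o: "inv u a < inv u b" "inv u b < inv u c" using oi oj right by (auto simp: a_def b_def c_def)
    have ginv: "inv g a = inv u a" "inv g b = inv u c" "inv g c = inv u b"
      using ab by (auto simp: gi b_def[symmetric] c_def[symmetric])
    have vals1: "(x \<circ> ?s i) i = b" "(x \<circ> ?s i) j = a" "(x \<circ> ?s i) (Suc j) = c"
      and vals2: "(x \<circ> ?s i \<circ> ?s j) i = b" "(x \<circ> ?s i \<circ> ?s j) (Suc i) = c"
      and vals3: "(x \<circ> ?s j) i = a" "(x \<circ> ?s j) (Suc i) = c"
      and vals4: "(x \<circ> ?s j \<circ> ?s i) j = a" "(x \<circ> ?s j \<circ> ?s i) (Suc j) = b"
      using right by (auto simp: simple_gen_def Transposition.transpose_def a_def b_def c_def)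
    have gac: "?T a c \<circ> g \<notin> lower"
      using ab o by (intro not_lower_up gL g abc) (auto simp: ginv)
    have gacS: "?T a c \<circ> g \<in> Sym n" by (intro transpose_comp_Sym g abc)
    have gab: "?T a b \<circ> g \<notin> lower"
      using ab o by (intro not_lower_up gL g abc) (auto simp: ginv)
    have gacab: "?T a b \<circ> (?T a c \<circ> g) \<notin> lower"
      using ab o by (intro not_lower_up gac gacS abc) (auto simp: ginv inv_transpose_comp[OF g])
    have "?T a c \<circ> v \<notin> lower \<and> ?T b c \<circ> v \<notin> lower"
      using v_cases
    proof
      assume "v = u"
      moreover have "?T a c \<circ> u = ?T a b \<circ> (?T a c \<circ> g)"
        unfolding geq using ab by (intro transpose_three(3)) auto
      ultimately show ?thesis using gacab gL geq by simp
    next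
      assume "v = ?T (x i) (x (Suc i)) \<circ> u"
      then have v: "v = ?T a b \<circ> u" using right by (simp add: a_def b_def)
      have "?T a c \<circ> v = ?T a b \<circ> g" "?T b c \<circ> v = ?T a c \<circ> g"
        unfolding geq v using ab by (intro transpose_three(1,2); simp)+
      then show ?thesis using gab gac by simp
    qed
    then have b1: "?T a c \<circ> v \<notin> lower" and b2: "?T b c \<circ> v \<notin> lower" by auto
    have s1: "vertex (x \<circ> ?s i \<circ> ?s j) = v"
      by (rule stay[OF si]) (use ab j vals1 b1 svi in auto)
    have sij: "x \<circ> ?s i \<circ> ?s j \<in> Sym n" and sji: "x \<circ> ?s j \<circ> ?s i \<in> Sym n"
      using si sj sS Sym_comp by blast+
    have s2: "vertex (x \<circ> ?s i \<circ> ?s j \<circ> ?s i) = v"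
      by (rule stay[OF sij]) (use ab i vals2 b2 s1 svi in auto)
    have "weak_le n (x \<circ> ?s i) (x \<circ> ?s i \<circ> ?s j)"
      using vals1 ab j by (intro weak_le_simple_gen si) auto
    moreover have "weak_le n (x \<circ> ?s i \<circ> ?s j) (x \<circ> ?s i \<circ> ?s j \<circ> ?s i)"
      using vals2 ab i by (intro weak_le_simple_gen sij) auto
    moreover have "weak_le n (x \<circ> ?s j) (x \<circ> ?s j \<circ> ?s i)"
      using vals3 ab i by (intro weak_le_simple_gen sj) auto
    moreover have "weak_le n (x \<circ> ?s j \<circ> ?s i) (x \<circ> ?s j \<circ> ?s i \<circ> ?s j)"
      using vals4 ab j by (intro weak_le_simple_gen sji) auto
    moreover have "x \<circ> ?s i \<circ> ?s j \<circ> ?s i = x \<circ> ?s j \<circ> ?s i \<circ> ?s j"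
      unfolding right by (simp only: simple_gen_braid)
    ultimately have "weak_le n (x \<circ> ?s i) (x \<circ> ?s i \<circ> ?s j \<circ> ?s i)"
      "weak_le n (x \<circ> ?s j) (x \<circ> ?s i \<circ> ?s j \<circ> ?s i)"
      using weak_le_trans by metis+
    then show ?thesis using s2 svi by (intro exI conjI) simp_all
  next
    case left
    define a b c where "a = x j" and "b = x i" and "c = x (Suc i)"
    have ab: "a < b" "b < c" using i j left by (auto simp: a_def b_def c_def)
    have abc: "a \<in> {1..n}" "b \<in> {1..n}" "c \<in> {1..n}" unfolding a_def b_def c_def by (intro r ir)+
    have o: "inv u a < inv u b" "inv u b < inv u c" using oi oj left by (auto simp: a_def b_def c_def)
    have b': "x (Suc j) = b" using left by (simp add: b_def)
    have geq: "g = ?T a b \<circ> u" by (simp add: g_def b' a_def)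
    have ginv: "inv g a = inv u b" "inv g b = inv u a" "inv g c = inv u c"
      using ab by (auto simp: gi b' a_def[symmetric])
    have vals1: "(x \<circ> ?s i) j = a" "(x \<circ> ?s i) (Suc j) = c" "(x \<circ> ?s i) (Suc i) = b"
      and vals2: "(x \<circ> ?s i \<circ> ?s j) i = a" "(x \<circ> ?s i \<circ> ?s j) (Suc i) = b"
      and vals3: "(x \<circ> ?s j) i = a" "(x \<circ> ?s j) (Suc i) = c"
      and vals4: "(x \<circ> ?s j \<circ> ?s i) j = b" "(x \<circ> ?s j \<circ> ?s i) (Suc j) = c"
      using left by (auto simp: simple_gen_def Transposition.transpose_def a_def b_def c_def)
    have gac: "?T a c \<circ> g \<notin> lower"
      using ab o by (intro not_lower_up gL g abc) (auto simp: ginv)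
    have gacS: "?T a c \<circ> g \<in> Sym n" by (intro transpose_comp_Sym g abc)
    have gbc: "?T b c \<circ> g \<notin> lower"
      using ab o by (intro not_lower_up gL g abc) (auto simp: ginv)
    have gacbc: "?T b c \<circ> (?T a c \<circ> g) \<notin> lower"
      using ab o by (intro not_lower_up gac gacS abc) (auto simp: ginv inv_transpose_comp[OF g])
    have "?T a c \<circ> v \<notin> lower \<and> ?T a b \<circ> v \<notin> lower"
      using v_cases
    proof
      assume "v = u"
      moreover have "?T a c \<circ> u = ?T b c \<circ> (?T a c \<circ> g)"
        unfolding geq using ab by (intro transpose_three(4)) auto
      ultimately show ?thesis using gacbc gL geq by simp
    next
      assume "v = ?T (x i) (x (Suc i)) \<circ> u"
      then have v: "v = ?T b c \<circ> u" by (simp add: b_def c_def)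
      have "?T a c \<circ> v = ?T b c \<circ> g" "?T a b \<circ> v = ?T a c \<circ> g"
        unfolding geq v using transpose_three[of c b a u] transpose_three[of a b c u] ab
        by (simp_all add: transpose_commute)
      then show ?thesis using gbc gac by simp
    qed
    then have b1: "?T a c \<circ> v \<notin> lower" and b2: "?T a b \<circ> v \<notin> lower" by auto
    have s1: "vertex (x \<circ> ?s i \<circ> ?s j) = v"
      by (rule stay[OF si]) (use ab j vals1 b1 svi in auto)
    have sij: "x \<circ> ?s i \<circ> ?s j \<in> Sym n" and sji: "x \<circ> ?s j \<circ> ?s i \<in> Sym n"
      using si sj sS Sym_comp by blast+
    have s2: "vertex (x \<circ> ?s i \<circ> ?s j \<circ> ?s i) = v"
      by (rule stay[OF sij]) (use ab i vals2 b2 s1 svi in auto)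
    have "weak_le n (x \<circ> ?s i) (x \<circ> ?s i \<circ> ?s j)"
      using vals1 ab j by (intro weak_le_simple_gen si) auto
    moreover have "weak_le n (x \<circ> ?s i \<circ> ?s j) (x \<circ> ?s i \<circ> ?s j \<circ> ?s i)"
      using vals2 ab i by (intro weak_le_simple_gen sij) auto
    moreover have "weak_le n (x \<circ> ?s j) (x \<circ> ?s j \<circ> ?s i)"
      using vals3 ab i by (intro weak_le_simple_gen sj) auto
    moreover have "weak_le n (x \<circ> ?s j \<circ> ?s i) (x \<circ> ?s j \<circ> ?s i \<circ> ?s j)"
      using vals4 ab j by (intro weak_le_simple_gen sji) auto
    moreover have "x \<circ> ?s i \<circ> ?s j \<circ> ?s i = x \<circ> ?s j \<circ> ?s i \<circ> ?s j"
      unfolding left by (simp only: simple_gen_braid)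
    ultimately have "weak_le n (x \<circ> ?s i) (x \<circ> ?s i \<circ> ?s j \<circ> ?s i)"
      "weak_le n (x \<circ> ?s j) (x \<circ> ?s i \<circ> ?s j \<circ> ?s i)"
      using weak_le_trans by metis+
    then show ?thesis using s2 svi by (intro exI conjI) simp_all
  qed
qed

text \<open>
  By convexity every \<open>z\<close> in the class and above \<open>x\<close>, other than \<open>x\<close> itself, lies above some cover of \<open>x\<close>
  that is in the class. By induction each such cover has a greatest element above it in the class. Any
  two of these agree, since by \<open>vertex_polygon\<close> the class contains a common upper bound of the covers.
\<close>

lemma greatest_above:
  assumes "x \<in> Sym n"
  shows "\<exists>t. weak_le n x t \<and> vertex t = vertex x \<and> (\<forall>z. weak_le n x z \<and> vertex z = vertex x \<longrightarrow> weak_le n z t)"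
  using assms
proof (induction "n * n - ilen n x" arbitrary: x rule: less_induct)
  case less
  note x = less.prems
  have IH: "\<exists>t. weak_le n y t \<and> vertex t = vertex y \<and> (\<forall>z. weak_le n y z \<and> vertex z = vertex y \<longrightarrow> weak_le n z t)"
    if "y \<in> Sym n" "ilen n x < ilen n y" for y
    by (rule less.hyps) (use that ilen_le[of n y] in auto)
  show ?case
  proof (cases "\<exists>i\<in>{1..<n}. x i < x (Suc i) \<and> vertex (x \<circ> simple_gen i) = vertex x")
    case False
    have "z = x" if z: "weak_le n x z" "vertex z = vertex x" for z
    proof (rule ccontr)
      assume "z \<noteq> x"
      then obtain i where i: "i \<in> {1..<n}" "x i < x (Suc i)" "weak_le n (x \<circ> simple_gen i) z"
        using weak_le_first_step[OF z(1)] by blast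
      then have "vertex (x \<circ> simple_gen i) = vertex x"
        using vertex_convex[OF weak_le_simple_gen[OF x i(1,2)] i(3)] z by simp
      with False i show False by blast
    qed
    then show ?thesis by (intro exI[of _ x]) auto
  next
    case True
    then obtain i where i: "i \<in> {1..<n}" "x i < x (Suc i)" and fi: "vertex (x \<circ> simple_gen i) = vertex x" by blast
    have up: "x \<circ> simple_gen k \<in> Sym n \<and> ilen n x < ilen n (x \<circ> simple_gen k)"
      if "k \<in> {1..<n}" "x k < x (Suc k)" for k
      using that x Sym_comp Sym_simple_gen ilen_simple_gen_up[OF x that] by simp
    obtain t where t: "weak_le n (x \<circ> simple_gen i) t" "vertex t = vertex x"
      and tmax: "\<And>z. weak_le n (x \<circ> simple_gen i) z \<Longrightarrow> vertex z = vertex x \<Longrightarrow> weak_le n z t"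
      using IH[of "x \<circ> simple_gen i"] up[OF i] fi by auto
    have xt: "weak_le n x t" using weak_le_simple_gen[OF x i] t weak_le_trans by blast
    have "weak_le n z t" if z: "weak_le n x z" "vertex z = vertex x" for z
    proof (cases "z = x")
      case True
      then show ?thesis using xt by simp
    next
      case False
      then obtain j where j: "j \<in> {1..<n}" "x j < x (Suc j)" "weak_le n (x \<circ> simple_gen j) z"
        using weak_le_first_step[OF z(1)] by blast
      have fj: "vertex (x \<circ> simple_gen j) = vertex x"
        using vertex_convex[OF weak_le_simple_gen[OF x j(1,2)] j(3)] z by simp
      show ?thesis
      proof (cases "i = j")
        case True
        then show ?thesis using tmax j z by simp
      next
        case False
        obtain p where p: "weak_le n (x \<circ> simple_gen i) p" "weak_le n (x \<circ> simple_gen j) p" "vertex p = vertex x"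
          using vertex_polygon[OF x i j(1,2) False fj] fi by auto
        obtain t' where t': "weak_le n (x \<circ> simple_gen j) t'" "vertex t' = vertex x"
          and tmax': "\<And>z. weak_le n (x \<circ> simple_gen j) z \<Longrightarrow> vertex z = vertex x \<Longrightarrow> weak_le n z t'"
          using IH[of "x \<circ> simple_gen j"] up[OF j(1,2)] fj by auto
        have "weak_le n p t'" using tmax' p by blast
        then have "weak_le n (x \<circ> simple_gen i) t'" using p weak_le_trans by blast
        then have "weak_le n t' t" using tmax t' by blast
        moreover have "weak_le n z t'" using tmax' j z by blast
        ultimately show ?thesis using weak_le_trans by blast
      qed
    qed
    then show ?thesis using xt t by blast
  qed
qed

definition class_top :: "(nat \<Rightarrow> nat) \<Rightarrow> nat \<Rightarrow> nat" where
  "class_top x = (SOME t. t \<in> Sym n \<and> vertex t = vertex x \<and> (\<forall>y\<in>Sym n. vertex y = vertex x \<longrightarrow> weak_le n y t))"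

lemma class_top_greatest:
  assumes x: "x \<in> Sym n"
  shows class_top_Sym: "class_top x \<in> Sym n" and vertex_class_top: "vertex (class_top x) = vertex x"
    and le_class_top: "\<And>y. y \<in> Sym n \<Longrightarrow> vertex y = vertex x \<Longrightarrow> weak_le n y (class_top x)"
proof -
  let ?u = "vertex x"
  have u: "?u \<in> Sym n" "vertex ?u = vertex x" using vertex_Sym vertex_mem vertex_fixed x by auto
  obtain t where t: "weak_le n ?u t" "vertex t = vertex x"
    "\<And>z. weak_le n ?u z \<Longrightarrow> vertex z = vertex x \<Longrightarrow> weak_le n z t"
    using greatest_above[OF u(1)] u(2) by auto
  have "t \<in> Sym n" using weak_le_Sym t(1) u(1) by blast
  moreover have "weak_le n y t" if "y \<in> Sym n" "vertex y = vertex x" for y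
    using vertex_weak_le[OF that(1)] that t(3) by simp
  ultimately have "\<exists>t. t \<in> Sym n \<and> vertex t = vertex x \<and> (\<forall>y\<in>Sym n. vertex y = vertex x \<longrightarrow> weak_le n y t)"
    using t(2) by blast
  from someI_ex[OF this] show "class_top x \<in> Sym n" "vertex (class_top x) = vertex x"
    "\<And>y. y \<in> Sym n \<Longrightarrow> vertex y = vertex x \<Longrightarrow> weak_le n y (class_top x)"
    unfolding class_top_def by blast+
qed

lemma class_top_cong: "vertex x = vertex y \<Longrightarrow> class_top x = class_top y"
  by (simp add: class_top_def)

text \<open>
  The class of \<open>x\<close> is an interval of the weak order.
\<close>

lemma vertex_fibre:
  assumes "x \<in> Sym n" "y \<in> Sym n"
  shows "vertex y = vertex x \<longleftrightarrow> weak_le n (vertex x) y \<and> weak_le n y (class_top x)"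
  using vertex_convex[of "vertex x" y "class_top x"] vertex_fixed[OF vertex_mem[OF assms(1)]] vertex_class_top[OF assms(1)]
    vertex_weak_le[OF assms(2)] le_class_top[OF assms] by auto

text \<open>
  If \<open>x\<close> is not the top of its class, some cover \<open>z\<close> of \<open>x\<close> lies in the class. By
  \<open>vertex_polygon\<close>, some common upper bound \<open>p\<close> of \<open>y\<close> and \<open>z\<close> is equivalent to \<open>y\<close>. The path from \<open>z\<close> to \<open>p\<close> starts above \<open>x\<close>, so the
  induction applies to each of its steps and compares the tops of \<open>z\<close> and \<open>p\<close>, which are those of \<open>x\<close>
  and \<open>y\<close>.
\<close>

lemma class_top_mono_cover:
  assumes "weak_cover n x y"
  shows "weak_le n (class_top x) (class_top y)"
  using assms
proof (induction "n * n - ilen n x" arbitrary: x y rule: less_induct)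
  case less
  obtain i where x: "x \<in> Sym n" and i: "i \<in> {1..<n}" "x i < x (Suc i)" and y: "y = x \<circ> simple_gen i"
    using less.prems by (rule weak_coverE)
  have yS: "y \<in> Sym n" using less.prems weak_cover_Sym by blast
  show ?case
  proof (cases "class_top x = x")
    case True
    then show ?thesis using weak_cover_le[OF less.prems] le_class_top[OF yS yS refl] weak_le_trans by auto
  next
    case False
    then obtain j where j: "j \<in> {1..<n}" "x j < x (Suc j)" "weak_le n (x \<circ> simple_gen j) (class_top x)"
      using weak_le_first_step[OF le_class_top[OF x x refl]] by auto
    let ?z = "x \<circ> simple_gen j"
    have fj: "vertex ?z = vertex x"
      using vertex_convex[OF weak_le_simple_gen[OF x j(1,2)] j(3)] vertex_class_top[OF x] by simp
    show ?thesis
    proof (cases "i = j")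
      case True
      then have "class_top y = class_top x" using fj y by (intro class_top_cong) simp
      then show ?thesis by simp
    next
      case False
      obtain p where p: "weak_le n y p" "weak_le n ?z p" "vertex p = vertex y"
        using vertex_polygon[OF x i j(1,2) False fj] y by auto
      have lz: "ilen n ?z = ilen n x + 1" using ilen_simple_gen_up[OF x j(1,2)] .
      have "weak_le n (class_top z) (class_top q) \<and> ilen n x < ilen n q"
        if "weak_le n z q" "ilen n x < ilen n z" for z q
        using that(1)[unfolded weak_le_def]
      proof (induction rule: rtranclp_induct)
        case base
        then show ?case using that(2) by simp
      next
        case (step q r)
        have "weak_le n (class_top q) (class_top r)"
          by (rule less.hyps) (use step ilen_le[of n q] in auto)
        then show ?case using step weak_cover_ilen[OF step(2)] weak_le_trans by auto
      qed
      then have "weak_le n (class_top ?z) (class_top p)" using p(2) lz by simp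
      then show ?thesis using class_top_cong[OF fj] class_top_cong[OF p(3)] by simp
    qed
  qed
qed

lemma class_top_mono:
  assumes "weak_le n x y"
  shows "weak_le n (class_top x) (class_top y)"
  using assms unfolding weak_le_def
proof (induction rule: rtranclp_induct)
  case (step y z)
  then show ?case using class_top_mono_cover[of y z] unfolding weak_le_def by simp
qed simp

end

section \<open>Linear functionals on permutation vectors\<close>

text \<open>
  The value of the functional \<open>h\<close> at the point of \<open>u\<close> is the pairing with \<open>k = u\<^sup>-\<^sup>1\<close>; composing both
  arguments with a permutation of the indices does not change it.
\<close>

definition pairing :: "nat \<Rightarrow> (nat \<Rightarrow> real) \<Rightarrow> (nat \<Rightarrow> nat) \<Rightarrow> real" where
  "pairing n h k = (\<Sum>i\<in>{1..n}. h i * real (k i))"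

lemma pairing_comp:
  assumes "y \<in> Sym n"
  shows "pairing n (h \<circ> y) (k \<circ> y) = pairing n h k"
proof -
  have "y permutes {1..n}" using assms by (simp add: Sym_def)
  from sum.permute[OF this, of "\<lambda>i. h i * real (k i)"] show ?thesis
    unfolding pairing_def by (simp add: o_def)
qed

lemma pairing_transpose:
  assumes "p \<in> {1..n}" "q \<in> {1..n}" "p < q"
  shows "pairing n h k - pairing n h (k \<circ> Transposition.transpose p q)
    = (h q - h p) * (real (k q) - real (k p))"
proof -
  have "pairing n h k - pairing n h (k \<circ> Transposition.transpose p q)
      = (\<Sum>i\<in>{1..n}. h i * (real (k i) - real (k (Transposition.transpose p q i))))"
    unfolding pairing_def by (simp add: sum_subtractf right_diff_distrib)
  also have "\<dots> = (\<Sum>i\<in>{p, q}. h i * (real (k i) - real (k (Transposition.transpose p q i))))"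
    by (rule sum.mono_neutral_right) (use assms in \<open>auto simp: Transposition.transpose_def\<close>)
  also have "\<dots> = (h q - h p) * (real (k q) - real (k p))"
    using assms by (simp add: algebra_simps)
  finally show ?thesis .
qed

text \<open>
  A Bruhat step moves a larger entry of \<open>k\<close> to an earlier position, where \<open>h\<close> is not larger.
\<close>

lemma pairing_antimono:
  assumes mono: "mono_on {1..n} h" and le: "bruhat_le n k k'"
  shows "pairing n h k' \<le> pairing n h k"
  using le[unfolded bruhat_le_iff_up]
proof (induction rule: rtranclp_induct)
  case (step k' k'')
  from step(2) obtain p q where pq: "p \<in> {1..n}" "q \<in> {1..n}" "p < q" "k' p < k' q"
    and k'': "k'' = k' \<circ> Transposition.transpose p q"
    by (rule bruhat_upE)
  have "h p \<le> h q" using mono pq by (auto intro: mono_onD)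
  then have "0 \<le> pairing n h k' - pairing n h k''"
    unfolding k'' pairing_transpose[OF pq(1-3)] using pq(4) by simp
  then show ?case using step by simp
qed simp

text \<open>
  Equality along a Bruhat chain forces equality in each step, hence every step exchanges two positions
  at which \<open>h\<close> agrees. If \<open>i, i + 1\<close> is the only such pair, all steps are multiplication by \<open>s\<^sub>i\<close>.
\<close>

lemma pairing_eq_imp:
  assumes mono: "mono_on {1..n} h" and le: "bruhat_le n k k'"
    and eq: "pairing n h k = pairing n h k'"
    and gaps: "\<And>p q. p \<in> {1..n} \<Longrightarrow> q \<in> {1..n} \<Longrightarrow> p < q \<Longrightarrow> h p = h q \<Longrightarrow> p = i \<and> q = Suc i"
  shows "k' = k \<or> k' = k \<circ> simple_gen i"
  using le[unfolded bruhat_le_iff_up] eq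
proof (induction rule: rtranclp_induct)
  case (step k' k'')
  from step(2) obtain p q where pq: "p \<in> {1..n}" "q \<in> {1..n}" "p < q" "k' p < k' q"
    and k'': "k'' = k' \<circ> Transposition.transpose p q"
    by (rule bruhat_upE)
  have 1: "pairing n h k' \<le> pairing n h k"
    by (rule pairing_antimono[OF mono]) (use step(1) in \<open>simp add: bruhat_le_iff_up\<close>)
  have "h p \<le> h q" using mono pq by (auto intro: mono_onD)
  then have "0 \<le> (h q - h p) * (real (k' q) - real (k' p))" using pq(4) by simp
  then have z: "(h q - h p) * (real (k' q) - real (k' p)) = 0" and eq': "pairing n h k = pairing n h k'"
    using 1 step.prems pairing_transpose[OF pq(1-3), of h k'] unfolding k'' by linarith+
  have "p = i \<and> q = Suc i" using z pq by (intro gaps) auto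
  then have "k'' = k' \<circ> simple_gen i" unfolding k'' simple_gen_def by simp
  then show ?case using step.IH[OF eq'] by (elim disjE) (simp_all only: simple_gen_invol simp_thms)
qed simp

lemma pairing_strict:
  assumes mono: "strict_mono_on {1..n} h" and le: "bruhat_le n k k'" and ne: "k \<noteq> k'"
  shows "pairing n h k' < pairing n h k"
proof -
  have m: "mono_on {1..n} h" using mono by (rule strict_mono_on_imp_mono_on)
  have "pairing n h k \<noteq> pairing n h k'"
  proof
    assume eq: "pairing n h k = pairing n h k'"
    have gap: False if "p \<in> {1..n}" "q \<in> {1..n}" "p < q" "h p = h q" for p q
      using strict_mono_onD[OF mono that(1-3)] that(4) by simp
    have "k' = k \<or> k' = k \<circ> simple_gen 0"
      by (rule pairing_eq_imp[OF m le eq]) (use gap in blast)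
    moreover have "k' = k \<or> k' = k \<circ> simple_gen (Suc 0)"
      by (rule pairing_eq_imp[OF m le eq]) (use gap in blast)
    \<comment> \<open>With no ties, the exceptional pair of \<open>pairing_eq_imp\<close> may be placed anywhere.\<close>
    ultimately have eq01: "k \<circ> simple_gen 0 = k \<circ> simple_gen (Suc 0)" using ne by metis
    have kS: "k \<in> Sym n" using bruhat_le_Sym[OF le] ne by blast
    from eq01 have "k (simple_gen 0 0) = k (simple_gen (Suc 0) 0)" by (metis comp_apply)
    then show False using Sym_eq_iff[OF kS, of 1 0] by (simp add: simple_gen_def)
  qed
  then show ?thesis using pairing_antimono[OF m le] by simp
qed

text \<open>
  The inverse of \<open>y\<close> assigns to each index its rank, where ties of \<open>h\<close> are broken in favour of the
  smaller index. This choice makes \<open>y\<close> the weak order minimum of all permutations that sort \<open>h\<close>.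
\<close>

lemma sorting_permutation:
  fixes h :: "nat \<Rightarrow> real"
  obtains y where "y \<in> Sym n" "mono_on {1..n} (h \<circ> y)"
    "\<And>a b. (a, b) \<in> Inv n y \<longleftrightarrow> a \<in> {1..n} \<and> b \<in> {1..n} \<and> a < b \<and> h b < h a"
proof -
  define R where "R a b \<longleftrightarrow> h a < h b \<or> h a = h b \<and> a < b" for a b
  define r where "r b = (if b \<in> {1..n} then Suc (card {a\<in>{1..n}. R a b}) else b)" for b
  have r_mono: "r a < r b" if "a \<in> {1..n}" "b \<in> {1..n}" "R a b" for a b
  proof -
    have "{c\<in>{1..n}. R c a} \<subset> {c\<in>{1..n}. R c b}"
      using that by (auto simp: R_def)
    then have "card {c\<in>{1..n}. R c a} < card {c\<in>{1..n}. R c b}"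
      by (intro psubset_card_mono) auto
    then show ?thesis using that by (simp add: r_def)
  qed
  have tot: "R a b \<or> R b a" if "a \<noteq> b" for a b using that by (auto simp: R_def)
  have inj: "inj_on r {1..n}"
    using r_mono tot by (intro inj_onI) (metis less_irrefl)
  have "r b \<in> {1..n}" if b: "b \<in> {1..n}" for b
  proof -
    have "{a\<in>{1..n}. R a b} \<subseteq> {1..n} - {b}" by (auto simp: R_def)
    then have "card {a\<in>{1..n}. R a b} \<le> card ({1..n} - {b})" by (intro card_mono) auto
    moreover have "0 < n" using b by auto
    ultimately show ?thesis using b by (auto simp add: r_def)
  qed
  then have "r ` {1..n} = {1..n}"
    using inj by (intro endo_inj_surj) auto
  then have "r permutes {1..n}"
    using inj by (intro bij_imp_permutes) (auto simp: bij_betw_def r_def)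
  then have rS: "r \<in> Sym n" by (simp add: Sym_def)
  have R_iff: "R a b \<longleftrightarrow> r a < r b" if "a \<in> {1..n}" "b \<in> {1..n}" for a b
    using r_mono[OF that] r_mono[OF that(2,1)] tot[of a b] by (cases "a = b") (auto simp: R_def)
  have iS: "inv r \<in> Sym n" using rS by (rule Sym_inv)
  show thesis
  proof
    show "mono_on {1..n} (h \<circ> inv r)"
    proof (rule mono_onI)
      fix p q assume pq: "p \<in> {1..n}" "q \<in> {1..n}" "p \<le> q"
      have "\<not> R (inv r q) (inv r p)"
        using pq rS R_iff[OF Sym_app_mem[OF iS pq(2)] Sym_app_mem[OF iS pq(1)]] by simp
      then show "(h \<circ> inv r) p \<le> (h \<circ> inv r) q" by (auto simp: R_def)
    qed
    show "(a, b) \<in> Inv n (inv r) \<longleftrightarrow> a \<in> {1..n} \<and> b \<in> {1..n} \<and> a < b \<and> h b < h a" for a b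
      using rS R_iff[of b a] by (auto simp: Inv_iff R_def)
  qed (rule iS)
qed

section \<open>Normal cones and the classes\<close>

locale numbered_bruhat_interval = bruhat_interval n w for n w +
  fixes c :: "'n::finite \<Rightarrow> nat"
  assumes c: "bij_betw c UNIV {1..n}"
begin

abbreviation "pt \<equiv> perm_point c"
abbreviation "Q \<equiv> bruhat_polytope n c w"

definition coord :: "real ^ 'n \<Rightarrow> nat \<Rightarrow> real" where
  "coord x k = x $ inv c k"

lemma inv_c: "inv c (c j) = j" "k \<in> {1..n} \<Longrightarrow> c (inv c k) = k"
  using c by (auto simp: bij_betw_def inv_f_f f_inv_into_f)

lemma coord_c [simp]: "coord x (c j) = x $ j"
  by (simp add: coord_def inv_c)

lemma coord_pt [simp]: "k \<in> {1..n} \<Longrightarrow> coord (pt u) k = real (inv u k)"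
  by (simp add: coord_def perm_point_def inv_c)

lemma inner_pt: "x \<bullet> pt u = pairing n (coord x) (inv u)"
proof -
  have "x \<bullet> pt u = (\<Sum>j\<in>UNIV. coord x (c j) * real (inv u (c j)))"
    by (simp add: inner_vec_def perm_point_def)
  also have "\<dots> = pairing n (coord x) (inv u)"
    unfolding pairing_def using sum.reindex_bij_betw[OF c, of "\<lambda>k. coord x k * real (inv u k)"] .
  finally show ?thesis .
qed

lemma inner_pt_comp:
  "y \<in> Sym n \<Longrightarrow> x \<bullet> pt u = pairing n (coord x \<circ> y) (inv u \<circ> y)"
  by (simp add: inner_pt pairing_comp)

lemma pt_eq_iff:
  assumes "u \<in> Sym n" "v \<in> Sym n"
  shows "pt u = pt v \<longleftrightarrow> u = v"
proof
  assume eq: "pt u = pt v"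
  have "inv u k = inv v k" for k
  proof (cases "k \<in> {1..n}")
    case True
    then show ?thesis using coord_pt[OF True, of u] coord_pt[OF True, of v] eq by simp
  next
    case False
    then show ?thesis using assms[THEN Sym_inv] by (simp add: Sym_def permutes_not_in)
  qed
  then have "inv u = inv v" by (rule ext)
  then show "u = v" using assms by (metis Sym_inv_app(5))
qed simp

lemma pt_in_polytope: "u \<in> lower \<Longrightarrow> pt u \<in> Q"
  unfolding bruhat_polytope_def by (simp add: hull_inc)

lemma vertex_argmax:
  assumes y: "y \<in> Sym n" and x: "mono_on {1..n} (coord x \<circ> y)" and v: "v \<in> lower"
  shows "x \<bullet> pt v \<le> x \<bullet> pt (vertex y)"
  unfolding inner_pt_comp[OF y] by (rule pairing_antimono[OF x vertex_min[OF y v]])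

lemma vertex_strict_argmax:
  assumes y: "y \<in> Sym n" and v: "v \<in> lower" "v \<noteq> vertex y"
  shows "pt y \<bullet> pt v < pt y \<bullet> pt (vertex y)"
  unfolding inner_pt_comp[OF y]
proof (rule pairing_strict[OF _ vertex_min[OF y v(1)]])
  show "strict_mono_on {1..n} (coord (pt y) \<circ> y)"
    using y Sym_app_mem[OF y] by (intro strict_mono_onI) (simp del: atLeastAtMost_iff)
  show "inv (vertex y) \<circ> y \<noteq> inv v \<circ> y"
    using comp_cancel[OF vertex_Sym[OF y] lower_Sym[OF v(1)] y] v(2) by blast
qed

lemma normal_cone_iff:
  assumes "u \<in> lower"
  shows "x \<in> normal_cone n c w u \<longleftrightarrow> (\<forall>v\<in>lower. x \<bullet> pt v \<le> x \<bullet> pt u)"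
proof -
  have "Q \<subseteq> {z. x \<bullet> z \<le> x \<bullet> pt u}" if "\<forall>v\<in>lower. x \<bullet> pt v \<le> x \<bullet> pt u"
    unfolding bruhat_polytope_def
    by (rule hull_minimal) (use that in \<open>auto simp: convex_halfspace_le\<close>)
  then show ?thesis
    unfolding normal_cone_def is_arg_max_def using pt_in_polytope assms by (force simp: not_less)
qed

text \<open>
  On a connected set that avoids the hyperplane \<open>x\<^sub>j = x\<^sub>k\<close>, the difference of these coordinates keeps
  its sign. Hence the points of the open chamber are ordered like the permutation vector, and weak
  inequalities survive in the closure.
\<close>

lemma braid_cone_mono:
  assumes y: "y \<in> Sym n" and x: "x \<in> braid_cone c y"
  shows "mono_on {1..n} (coord x \<circ> y)"
proof -
  define K :: "(real ^ 'n) set" where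
    "K = {x. \<forall>p q. p \<in> {1..n} \<longrightarrow> q \<in> {1..n} \<longrightarrow> p < q \<longrightarrow> x $ inv c (y p) \<le> x $ inv c (y q)}"
  have "closed K"
    unfolding K_def
    by (intro closed_Collect_all closed_Collect_imp closed_Collect_le open_Collect_const
        continuous_intros)
  moreover have "connected_component_set (- \<Union>braid_hyperplanes) (pt y) \<subseteq> K"
  proof
    fix x assume "x \<in> connected_component_set (- \<Union>braid_hyperplanes) (pt y)"
    then obtain T where T: "connected T" "T \<subseteq> - \<Union>braid_hyperplanes" "pt y \<in> T" "x \<in> T"
      by (auto simp: connected_component_def)
    have "x $ inv c (y p) \<le> x $ inv c (y q)" if pq: "p \<in> {1..n}" "q \<in> {1..n}" "p < q" for p q
    proof (rule ccontr)
      assume not: "\<not> ?thesis"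
      define f where "f z = z $ inv c (y q) - z $ inv c (y p)" for z :: "real ^ 'n"
      have "connected (f ` T)"
        unfolding f_def by (intro connected_continuous_image continuous_intros T)
      moreover have "f x \<in> f ` T" "f (pt y) \<in> f ` T" using T by auto
      moreover have "f x \<le> 0" using not by (simp add: f_def)
      moreover have "0 \<le> f (pt y)"
        using pq y Sym_app_mem[OF y] inv_c by (simp add: f_def perm_point_def del: atLeastAtMost_iff)
      ultimately have "0 \<in> f ` T" using connectedD_interval by blast
      then obtain z where z: "z \<in> T" "z $ inv c (y p) = z $ inv c (y q)" by (auto simp: f_def)
      have "y p \<noteq> y q" using pq(3) Sym_eq_iff[OF y, of p q] by simp
      then have "inv c (y p) \<noteq> inv c (y q)"
        using inv_c(2)[OF Sym_app_mem[OF y pq(1)]] inv_c(2)[OF Sym_app_mem[OF y pq(2)]] by metis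
      then have "z \<in> \<Union>braid_hyperplanes" using z(2) unfolding braid_hyperplanes_def by blast
      then show False using T(2) z(1) by blast
    qed
    then show "x \<in> K" by (simp add: K_def)
  qed
  ultimately have "braid_cone c y \<subseteq> K" unfolding braid_cone_def by (intro closure_minimal)
  then have "x \<in> K" using x by blast
  then have "coord x (y p) \<le> coord x (y q)" if "p \<in> {1..n}" "q \<in> {1..n}" "p < q" for p q
    using that unfolding K_def coord_def by blast
  then show ?thesis
    by (intro mono_onI) (auto simp: le_less)
qed

lemma pt_in_braid_cone:
  assumes y: "y \<in> Sym n"
  shows "pt y \<in> braid_cone c y"
proof -
  have "pt y $ i \<noteq> pt y $ j" if "i \<noteq> j" for i j
    using that Sym_inv_eq_iff[OF y] inv_c(1) by (simp add: perm_point_def) metis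
  then have "pt y \<in> - \<Union>braid_hyperplanes" by (auto simp: braid_hyperplanes_def)
  then have "pt y \<in> connected_component_set (- \<Union>braid_hyperplanes) (pt y)"
    by (simp add: connected_component_refl)
  then show ?thesis unfolding braid_cone_def using closure_subset by blast
qed

text \<open>
  The vector of \<open>y\<close> lies in its own chamber and has \<open>vertex y\<close> as its only maximiser, which pins down
  \<open>u\<close>; conversely \<open>vertex y\<close> maximises all functionals of the chamber.
\<close>

lemma braid_cone_subset_iff:
  assumes y: "y \<in> Sym n" and u: "u \<in> lower"
  shows "braid_cone c y \<subseteq> normal_cone n c w u \<longleftrightarrow> u = vertex y"
proof
  assume "braid_cone c y \<subseteq> normal_cone n c w u"
  then have "pt y \<in> normal_cone n c w u" using pt_in_braid_cone[OF y] by blast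
  then have "pt y \<bullet> pt (vertex y) \<le> pt y \<bullet> pt u" using normal_cone_iff[OF u] vertex_mem[OF y] by blast
  then show "u = vertex y" using vertex_strict_argmax[OF y u] by force
next
  assume "u = vertex y"
  then show "braid_cone c y \<subseteq> normal_cone n c w u"
    using normal_cone_iff[OF u] vertex_argmax[OF y] braid_cone_mono[OF y] by blast
qed

lemma Theta_iff: "(y, y') \<in> Theta n c w \<longleftrightarrow> y \<in> Sym n \<and> y' \<in> Sym n \<and> vertex y = vertex y'"
  unfolding Theta_def using braid_cone_subset_iff vertex_mem by auto

lemma Theta_class_eq: "x \<in> Sym n \<Longrightarrow> Theta_class n c w x = {y \<in> Sym n. vertex y = vertex x}"
  unfolding Theta_class_def using Theta_iff by auto

lemma interval_unique:
  assumes "is_weak_interval n C b t" "is_weak_interval n C b' t'"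
  shows "b = b'" "t = t'"
  using assms weak_le_antisym unfolding is_weak_interval_def by blast+

lemma Theta_class_interval:
  assumes x: "x \<in> Sym n"
  shows "is_weak_interval n (Theta_class n c w x) (vertex x) (class_top x)"
proof -
  have s: "vertex x \<in> Sym n" "vertex (vertex x) = vertex x" using vertex_Sym vertex_fixed vertex_mem x by auto
  have "y \<in> Sym n \<and> vertex y = vertex x \<longleftrightarrow> weak_le n (vertex x) y \<and> weak_le n y (class_top x)" for y
    using vertex_fibre[OF x, of y] weak_le_Sym[OF _ s(1), of y] by blast
  then show ?thesis
    unfolding is_weak_interval_def Theta_class_eq[OF x] using s class_top_Sym[OF x] vertex_class_top[OF x] by auto
qed

lemma bot_elt_eq: "x \<in> Sym n \<Longrightarrow> bot_elt n c w x = vertex x"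
  and top_elt_eq: "x \<in> Sym n \<Longrightarrow> top_elt n c w x = class_top x"
  unfolding bot_elt_def top_elt_def
  using Theta_class_interval interval_unique by (intro the_equality; blast)+

section \<open>Edges of the polytope\<close>

text \<open>
  The sum \<open>p\<close> of the vectors of \<open>y\<close> and \<open>z\<close> lies in the closures of both chambers, so both vertices
  maximise it. In the order given by \<open>y\<close>, its only tie is at positions \<open>i, i + 1\<close>, so by
  \<open>pairing_eq_imp\<close> no other point of the interval does, and the face exposed by \<open>p\<close> is the segment.
\<close>

lemma skeleton_cover_if_weak_cover:
  assumes "weak_cover n y z" and ne: "vertex z \<noteq> vertex y"
  shows "skeleton_cover n c w (vertex y) (vertex z)"
proof -
  obtain i where y: "y \<in> Sym n" and i: "i \<in> {1..<n}" "y i < y (Suc i)" and z: "z = y \<circ> simple_gen i"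
    using assms(1) by (rule weak_coverE)
  have zS: "z \<in> Sym n" using weak_cover_Sym assms(1) by blast
  define u v where "u = vertex y" and "v = vertex z"
  have u: "u \<in> lower" "u \<in> Sym n" and v: "v \<in> lower" "v \<in> Sym n"
    using vertex_mem vertex_Sym y zS by (auto simp: u_def v_def)
  define p where "p = pt y + pt z"
  have s_mem: "simple_gen i k \<in> {1..n}" if "k \<in> {1..n}" for k
    using Sym_app_mem[OF Sym_simple_gen[OF i(1)] that] .
  have iz: "inv z k = simple_gen i (inv y k)" for k
    unfolding z simple_gen_def using inv_comp_transpose[OF y] by simp
  have ss: "simple_gen i (simple_gen i k) = k" for k by (simp add: simple_gen_def)
  have coord_p: "coord p k = real (inv y k) + real (simple_gen i (inv y k))" if "k \<in> {1..n}" for k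
    using coord_pt[OF that, of y] coord_pt[OF that, of z] iz[of k]
    by (simp add: p_def coord_def)
  have py: "(coord p \<circ> y) k = real k + real (simple_gen i k)" if "k \<in> {1..n}" for k
    using coord_p[OF Sym_app_mem[OF y that]] y by simp
  have pz: "(coord p \<circ> z) k = real k + real (simple_gen i k)" if "k \<in> {1..n}" for k
    using py[OF s_mem[OF that]] ss by (simp add: z)
  \<comment> \<open>Along \<open>y\<close> the functional \<open>p\<close> has the values \<open>k + s\<^sub>i(k)\<close>: increasing, except for one tie.\<close>
  have wall: "real k + real (simple_gen i k) < real l + real (simple_gen i l)
      \<or> (k = i \<and> l = Suc i \<and> real k + real (simple_gen i k) = real l + real (simple_gen i l))"
    if "k < l" for k l
    using that by (auto simp: simple_gen_def Transposition.transpose_def)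
  have mono_y: "mono_on {1..n} (coord p \<circ> y)"
    using py wall by (intro mono_onI) (metis le_neq_implies_less less_imp_le order_refl)
  have mono_z: "mono_on {1..n} (coord p \<circ> z)"
    using pz wall by (intro mono_onI) (metis le_neq_implies_less less_imp_le order_refl)
  have max: "p \<bullet> pt x \<le> p \<bullet> pt u" if "x \<in> lower" for x
    using vertex_argmax[OF y mono_y that] by (simp add: u_def)
  have pv: "p \<bullet> pt v = p \<bullet> pt u"
    using max[OF v(1)] vertex_argmax[OF zS mono_z u(1)] by (simp add: v_def)
  have only: "x = u \<or> x = v" if x: "x \<in> lower" "p \<bullet> pt x = p \<bullet> pt u" for x
  proof -
    have eq: "pairing n (coord p \<circ> y) (inv u \<circ> y) = pairing n (coord p \<circ> y) (inv x \<circ> y)"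
      if "x \<in> lower" "p \<bullet> pt x = p \<bullet> pt u" for x
      using that(2) by (simp add: inner_pt_comp[OF y])
    have gap: "k = i \<and> l = Suc i"
      if "k \<in> {1..n}" "l \<in> {1..n}" "k < l" "(coord p \<circ> y) k = (coord p \<circ> y) l" for k l
      using wall[OF that(3)] that(4) py[OF that(1)] py[OF that(2)] by auto
    have two: "inv x \<circ> y = inv u \<circ> y \<or> inv x \<circ> y = inv u \<circ> y \<circ> simple_gen i"
      if "x \<in> lower" "p \<bullet> pt x = p \<bullet> pt u" for x
      by (rule pairing_eq_imp[OF mono_y vertex_min[OF y that(1), folded u_def] eq[OF that] gap])
    have "inv v \<circ> y \<noteq> inv u \<circ> y" using comp_cancel[OF v(2) u(2) y] ne by (auto simp: u_def v_def)
    then have "inv v \<circ> y = inv u \<circ> y \<circ> simple_gen i" using two[OF v(1) pv] by blast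
    then have "inv x \<circ> y = inv u \<circ> y \<or> inv x \<circ> y = inv v \<circ> y" using two[OF x] by metis
    then show ?thesis using comp_cancel[OF lower_Sym[OF x(1)] _ y] u(2) v(2) by blast
  qed
  define F where "F = Q \<inter> {x. p \<bullet> x = p \<bullet> pt u}"
  have "Q \<subseteq> {x. p \<bullet> x \<le> p \<bullet> pt u}"
    unfolding bruhat_polytope_def
    by (rule hull_minimal) (use max in \<open>auto simp: convex_halfspace_le\<close>)
  then have face: "F face_of Q"
    unfolding F_def bruhat_polytope_def
    by (intro face_of_Int_supporting_hyperplane_le convex_convex_hull) (auto simp: bruhat_polytope_def)
  obtain S where S: "S \<subseteq> pt ` lower" "F = convex hull S"
    using face_of_convex_hull_subset[of "pt ` lower" F] face finite_lower
    unfolding bruhat_polytope_def by (auto intro: finite_imp_compact)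
  have "S \<subseteq> {pt u, pt v}"
  proof
    fix s assume s: "s \<in> S"
    then obtain x where x: "x \<in> lower" "s = pt x" using S by blast
    have "s \<in> F" using s S by (simp add: hull_inc)
    then show "s \<in> {pt u, pt v}" using only[OF x(1)] x(2) by (auto simp: F_def)
  qed
  then have "F \<subseteq> closed_segment (pt u) (pt v)"
    unfolding S(2) segment_convex_hull by (rule hull_mono)
  moreover have "closed_segment (pt u) (pt v) \<subseteq> F"
  proof (rule closed_segment_subset)
    show "convex F" unfolding S(2) by (rule convex_convex_hull)
  qed (use pt_in_polytope u v pv in \<open>auto simp: F_def\<close>)
  ultimately have "closed_segment (pt u) (pt v) face_of Q" using face by simp
  moreover have "aff_dim (closed_segment (pt u) (pt v)) = 1"
    using pt_eq_iff[OF u(2) v(2)] ne by (simp add: segment_convex_hull aff_dim_convex_hull aff_dim_2 u_def v_def)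
  ultimately have "closed_segment (pt u) (pt v) edge_of Q" by (simp add: edge_of_def)
  moreover have "coxeter_length n u < coxeter_length n v"
    using vertex_weak_cover[OF assms(1)] ne coxeter_length_eq[OF u(2)] coxeter_length_eq[OF v(2)]
    by (simp add: u_def v_def)
  ultimately show ?thesis using u v by (simp add: skeleton_cover_def u_def v_def)
qed

text \<open>
  Let \<open>a\<close> expose the edge, and let \<open>x0\<close> sort \<open>a\<close> with natural ties. If a small multiple of the vector of an
  end \<open>x\<close> is added to \<open>a\<close>, then \<open>x\<close> becomes the only maximiser, and since strict inequalities of \<open>a\<close>
  persist, the chamber reached lies above \<open>x0\<close>. The vertex of \<open>x0\<close> maximises \<open>a\<close>, so it is an end of the
  edge. It cannot be the longer one, because lengths of vertices do not drop on the way from \<open>x0\<close> to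
  the chamber of the shorter end.
\<close>

lemma weak_le_if_skeleton_cover:
  assumes cov: "skeleton_cover n c w u v"
  shows "\<exists>x y. weak_le n x y \<and> x \<in> Sym n \<and> y \<in> Sym n \<and> vertex x = u \<and> vertex y = v"
proof -
  have u: "u \<in> lower" "u \<in> Sym n" and v: "v \<in> lower" "v \<in> Sym n"
    and edge: "closed_segment (pt u) (pt v) edge_of Q"
    and len: "ilen n u < ilen n v"
    using cov lower_Sym coxeter_length_eq unfolding skeleton_cover_def by auto
  have "polyhedron Q"
    unfolding bruhat_polytope_def using finite_lower by (intro polyhedron_convex_hull) simp
  then have "closed_segment (pt u) (pt v) exposed_face_of Q"
    using edge exposed_face_of_polyhedron by (auto simp: edge_of_def)
  then obtain a b where ab: "Q \<subseteq> {x. a \<bullet> x \<le> b}" "closed_segment (pt u) (pt v) = Q \<inter> {x. a \<bullet> x = b}"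
    unfolding exposed_face_of_def by blast
  have le: "a \<bullet> pt x \<le> b" if "x \<in> lower" for x using ab(1) pt_in_polytope[OF that] by blast
  have eq: "a \<bullet> pt u = b" "a \<bullet> pt v = b" using ab(2) by auto
  have only: "x = u \<or> x = v" if x: "x \<in> lower" "a \<bullet> pt x = b" for x
  proof (rule ccontr)
    assume ne: "\<not> ?thesis"
    have "pt x \<in> closed_segment (pt u) (pt v)" using ab(2) pt_in_polytope x by auto
    then have seg: "pt x \<in> convex hull {pt u, pt v}" by (simp add: segment_convex_hull)
    have sx: "vertex x = x" using vertex_fixed x by blast
    have "pt x \<bullet> pt u < pt x \<bullet> pt x" "pt x \<bullet> pt v < pt x \<bullet> pt x"
      using vertex_strict_argmax[OF lower_Sym[OF x(1)]] u v ne sx by auto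
    then have "convex hull {pt u, pt v} \<subseteq> {z. pt x \<bullet> z < pt x \<bullet> pt x}"
      by (intro hull_minimal) (auto simp: convex_halfspace_lt)
    then show False using seg by blast
  qed
  define \<alpha> where "\<alpha> = coord a"
  \<comment> \<open>The entries of permutation vectors are at most \<open>n\<close>, so adding \<open>\<epsilon>\<close> times such a vector keeps all
    strict inequalities between coordinates of \<open>a\<close>.\<close>
  have "\<forall>\<^sub>F \<epsilon> in at_right 0. \<forall>jk\<in>{1..n} \<times> {1..n}. \<alpha> (fst jk) < \<alpha> (snd jk) \<longrightarrow> \<alpha> (fst jk) + \<epsilon> * real n < \<alpha> (snd jk)"
  proof (rule eventually_ball_finite, simp, rule ballI)
    fix jk assume "jk \<in> {1..n} \<times> {1..n}"
    have lim: "((\<lambda>\<epsilon>. \<alpha> (fst jk) + \<epsilon> * real n) \<longlongrightarrow> \<alpha> (fst jk) + 0 * real n) (at_right 0)"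
      by (intro tendsto_intros)
    show "\<forall>\<^sub>F \<epsilon> in at_right 0. \<alpha> (fst jk) < \<alpha> (snd jk) \<longrightarrow> \<alpha> (fst jk) + \<epsilon> * real n < \<alpha> (snd jk)"
    proof (cases "\<alpha> (fst jk) < \<alpha> (snd jk)")
      case True
      then show ?thesis using order_tendstoD(2)[OF lim, of "\<alpha> (snd jk)"] by simp
    qed simp
  qed
  moreover have "\<forall>\<^sub>F \<epsilon>::real in at_right 0. 0 < \<epsilon>" by (simp add: eventually_at_right_less)
  ultimately have "\<forall>\<^sub>F \<epsilon> in at_right 0. 0 < \<epsilon> \<and>
      (\<forall>jk\<in>{1..n} \<times> {1..n}. \<alpha> (fst jk) < \<alpha> (snd jk) \<longrightarrow> \<alpha> (fst jk) + \<epsilon> * real n < \<alpha> (snd jk))"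
    by (intro eventually_conj)
  then obtain \<epsilon> :: real where \<epsilon>0: "0 < \<epsilon>" and
    \<epsilon>1: "\<forall>jk\<in>{1..n} \<times> {1..n}. \<alpha> (fst jk) < \<alpha> (snd jk) \<longrightarrow> \<alpha> (fst jk) + \<epsilon> * real n < \<alpha> (snd jk)"
    using eventually_happens'[OF trivial_limit_at_right_real] by blast
  have \<epsilon>2: "\<alpha> j + \<epsilon> * real n < \<alpha> k" if "j \<in> {1..n}" "k \<in> {1..n}" "\<alpha> j < \<alpha> k" for j k
    using \<epsilon>1[rule_format, of "(j, k)"] that by simp
  obtain x0 where x0: "x0 \<in> Sym n" "mono_on {1..n} (\<alpha> \<circ> x0)"
    and Inv_x0: "\<And>j k. (j, k) \<in> Inv n x0 \<longleftrightarrow> j \<in> {1..n} \<and> k \<in> {1..n} \<and> j < k \<and> \<alpha> k < \<alpha> j"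
    using sorting_permutation by blast
  have above: "\<exists>y. weak_le n x0 y \<and> y \<in> Sym n \<and> vertex y = x" if x: "x \<in> lower" "a \<bullet> pt x = b" for x
  proof -
    have xS: "x \<in> Sym n" using lower_Sym x by blast
    define g where "g = a + \<epsilon> *\<^sub>R pt x"
    obtain y where y: "y \<in> Sym n" "mono_on {1..n} (coord g \<circ> y)"
      and Inv_y: "\<And>j k. (j, k) \<in> Inv n y \<longleftrightarrow> j \<in> {1..n} \<and> k \<in> {1..n} \<and> j < k \<and> coord g k < coord g j"
      using sorting_permutation by blast
    have cg: "coord g k = \<alpha> k + \<epsilon> * real (inv x k)" if "k \<in> {1..n}" for k
      using coord_pt[OF that, of x] by (simp add: g_def \<alpha>_def coord_def)
    have "vertex y = x"
    proof (rule ccontr)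
      assume ne: "vertex y \<noteq> x"
      have "pt x \<bullet> pt (vertex y) < pt x \<bullet> pt x"
        using vertex_strict_argmax[OF xS vertex_mem[OF y(1)]] ne vertex_fixed[OF x(1)] by simp
      then have "\<epsilon> * (pt x \<bullet> pt (vertex y)) < \<epsilon> * (pt x \<bullet> pt x)" using \<epsilon>0 by simp
      moreover have "a \<bullet> pt (vertex y) \<le> a \<bullet> pt x" using le[OF vertex_mem[OF y(1)]] x by simp
      ultimately have "g \<bullet> pt (vertex y) < g \<bullet> pt x" by (simp add: g_def inner_add_left)
      then show False using vertex_argmax[OF y x(1)] by simp
    qed
    moreover have "Inv n x0 \<subseteq> Inv n y"
    proof
      fix jk assume jk: "jk \<in> Inv n x0"
      obtain j k where [simp]: "jk = (j, k)" by force
      have j: "j \<in> {1..n}" "k \<in> {1..n}" "j < k" "\<alpha> k < \<alpha> j" using jk Inv_x0 by auto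
      have "inv x k \<le> n" using Sym_app_mem[OF Sym_inv[OF xS] j(2)] by simp
      then have "\<epsilon> * real (inv x k) \<le> \<epsilon> * real n" using \<epsilon>0 by simp
      moreover have "0 \<le> \<epsilon> * real (inv x j)" using \<epsilon>0 by simp
      ultimately have "coord g k < coord g j" using \<epsilon>2[OF j(2,1,4)] cg j by simp
      then show "jk \<in> Inv n y" using j Inv_y by simp
    qed
    ultimately show ?thesis using weak_le_if_Inv_subset[OF x0(1) y(1)] y(1) by blast
  qed
  obtain y where y: "weak_le n x0 y" "y \<in> Sym n" "vertex y = u" using above[OF u(1) eq(1)] by blast
  obtain z where z: "weak_le n x0 z" "z \<in> Sym n" "vertex z = v" using above[OF v(1) eq(2)] by blast
  have "a \<bullet> pt (vertex x0) = b"
    using vertex_argmax[OF x0(1) x0(2)[unfolded \<alpha>_def] u(1)] eq(1) le[OF vertex_mem[OF x0(1)]] by simp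
  then have "vertex x0 = u \<or> vertex x0 = v" using only vertex_mem[OF x0(1)] by blast
  then have "vertex x0 = u" using vertex_mono[OF y(1)] y(3) len by auto
  then show ?thesis using z x0(1) by blast
qed

text \<open>
  Weak relations between representatives of classes do not compose directly; relations between their
  tops do.
\<close>

lemma skeleton_le_imp_class_top_le:
  assumes "skeleton_le n c w u v"
  shows "weak_le n (class_top u) (class_top v)"
  using assms unfolding skeleton_le_def
proof (induction rule: rtranclp_induct)
  case (step v v')
  obtain x y where xy: "weak_le n x y" "x \<in> Sym n" "y \<in> Sym n" "vertex x = v" "vertex y = v'"
    using weak_le_if_skeleton_cover[OF step(2)] by blast
  have "v \<in> lower" "v' \<in> lower" using step(2) by (auto simp: skeleton_cover_def)
  then have "class_top x = class_top v" "class_top y = class_top v'" using xy vertex_fixed by (auto intro: class_top_cong)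
  then show ?case using class_top_mono[OF xy(1)] step.IH weak_le_trans by simp
qed simp

lemma weak_le_imp_skeleton_le:
  assumes "weak_le n x y"
  shows "skeleton_le n c w (vertex x) (vertex y)"
  using assms unfolding weak_le_def
proof (induction rule: rtranclp_induct)
  case (step y z)
  show ?case
  proof (cases "vertex z = vertex y")
    case False
    then show ?thesis using skeleton_cover_if_weak_cover[OF step(2)] step.IH
      unfolding skeleton_le_def by (simp add: rtranclp.rtrancl_into_rtrancl)
  qed (use step.IH in simp)
qed (simp add: skeleton_le_def)

lemma quotient_le_iff:
  assumes x: "x \<in> Sym n" and y: "y \<in> Sym n"
  shows "quotient_le n (Theta_class n c w x) (Theta_class n c w y)
    \<longleftrightarrow> skeleton_le n c w (vertex x) (vertex y)"
proof
  assume "quotient_le n (Theta_class n c w x) (Theta_class n c w y)"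
  then show "skeleton_le n c w (vertex x) (vertex y)"
    unfolding quotient_le_def using Theta_class_eq x y weak_le_imp_skeleton_le by fastforce
next
  assume "skeleton_le n c w (vertex x) (vertex y)"
  then have "weak_le n (class_top (vertex x)) (class_top (vertex y))" by (rule skeleton_le_imp_class_top_le)
  moreover have "class_top (vertex z) = class_top z" if "z \<in> Sym n" for z
    using that vertex_fixed[OF vertex_mem] by (intro class_top_cong) simp
  ultimately have "weak_le n (class_top x) (class_top y)" using x y by simp
  then show "quotient_le n (Theta_class n c w x) (Theta_class n c w y)"
    unfolding quotient_le_def
    using Theta_class_eq x y class_top_Sym vertex_class_top by (intro bexI[of _ "class_top x"] bexI[of _ "class_top y"]) auto
qed

end

section \<open>The quotient and the skeleton\<close>

theorem theorem4p3:
  fixes n :: nat and c :: "'n::finite \<Rightarrow> nat" and w :: "nat \<Rightarrow> nat"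
  assumes "bij_betw c UNIV {1..n}"
    and "w \<in> Sym n"
  shows "(\<forall>x \<in> Sym n. top_elt n c w x \<in> Sym n) \<and>
    (\<forall>x \<in> Sym n. \<forall>y \<in> Sym n. weak_le n x y \<longrightarrow>
       weak_le n (top_elt n c w x) (top_elt n c w y)) \<and>
    (\<exists>f. (\<forall>x \<in> Sym n. f (Theta_class n c w x) = bot_elt n c w x) \<and>
       bij_betw f (Sym n // Theta n c w) (bruhat_lower n w) \<and>
       (\<forall>C \<in> Sym n // Theta n c w. \<forall>D \<in> Sym n // Theta n c w.
          quotient_le n C D \<longleftrightarrow> skeleton_le n c w (f C) (f D)))"
proof -
  interpret numbered_bruhat_interval n w c
    by unfold_locales (use assms in auto)
  let ?cls = "Theta_class n c w"
  \<comment> \<open>\<open>vertex\<close> is constant on a class, so its image is a singleton.\<close>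
  let ?f = "\<lambda>C. the_elem (vertex ` C)"
  have quot: "Sym n // Theta n c w = ?cls ` Sym n"
    by (auto simp: quotient_def Theta_class_def)
  have f: "?f (?cls x) = vertex x" if "x \<in> Sym n" for x
  proof -
    have "vertex ` ?cls x = {vertex x}" using Theta_class_eq[OF that] that by auto
    then show ?thesis by simp
  qed
  have "bij_betw ?f (?cls ` Sym n) lower"
    unfolding bij_betw_def
  proof
    show "inj_on ?f (?cls ` Sym n)"
      using f Theta_class_eq by (intro inj_onI) auto
    have "?f ` ?cls ` Sym n = vertex ` Sym n" unfolding image_image using f by (intro image_cong) auto
    also have "\<dots> = lower"
    proof
      show "lower \<subseteq> vertex ` Sym n" using vertex_fixed lower_Sym by (metis image_eqI subsetI)
    qed (use vertex_mem in auto)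
    finally show "?f ` ?cls ` Sym n = lower" .
  qed
  moreover have "\<forall>x\<in>Sym n. ?f (?cls x) = bot_elt n c w x" using f bot_elt_eq by simp
  moreover have "quotient_le n (?cls x) (?cls y) \<longleftrightarrow> skeleton_le n c w (?f (?cls x)) (?f (?cls y))"
    if "x \<in> Sym n" "y \<in> Sym n" for x y
    using that f quotient_le_iff by simp
  ultimately show ?thesis
    unfolding quot using class_top_Sym class_top_mono by (intro conjI exI[of _ ?f]) (auto simp: top_elt_eq)
qed

end
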